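(* Let $n\ge2$. For every sequence of real numbers $\lambda=(\lambda_1\ge\lambda_2\ge\cdots\ge\lambda_n\ge0)$ and every permutation $w\in S_{n-1}$, the weighted flag matroid polytope $\mathrm{FM}(\lambda,w)$ and the (image in $\mathbb{R}^n$ of the) Gelfand–Zetlin face $\mathrm{GZ}(\lambda,w)$ coincide as subsets of $\mathbb{R}^n$: $$\mathrm{FM}(\lambda,w)=\mathrm{GZ}(\lambda,w).$$
   Context: Write $[n]=\{1,\dots,n\}$; permutations are bijections $[n-1]\to[n-1]$. **The matrix $A_w$.** For $w\in S_{n-1}$, the $n\times n$ matrix $A_w$ is defined as follows. For $i=1,2,\dots,n-1$ in order: place the symbol $\star_2$ in row $i$ and column $w^{-1}(i)+1$; place the symbol $\star_1$ in row $i$ and in the right-most column that lies to the left of column $w^{-1}(i)+1$ and does not contain a symbol $\star_2$ in any row above row $i$. Then place $\star_2$ in row $n$ and column $1$. All other entries are $0$. Finally, replace all symbols $\star_1,\star_2$ by generic (in particular nonzero) complex numbers. **Weighted flag matroid polytope.** For a nonsingular $n\times n$ matrix $A$, $S\subset[n]$ and $j\in[n]$, let $A_{S,j}$ be the submatrix of $A$ formed by the rows indexed by $S$ and the first $j$ columns. Then $\mathrm{FM}(\lambda,A)\subset\mathbb{R}^n_{\ge0}$ is the set of $(z_1,\dots,z_n)$ satisfying $z_1+\cdots+z_n=\lambda_1+\cdots+\lambda_n$ and, for every $S\subset[n]$, $$\sum_{i\in S}z_i\le\sum_{j=1}^n(\lambda_j-\lambda_{j+1})\,\mathrm{rank}(A_{S,j}),\qquad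 \lambda_{n+1}:=0.$$ Put $\mathrm{FM}(\lambda,w)=\mathrm{FM}(\lambda,A_w)$. **Gelfand–Zetlin faces.** The Gelfand–Zetlin polytope $\mathrm{GZ}(\lambda)$ is the set of real vectors $(x_{k,\ell})_{1\le k<\ell\le n}$ such that, with $x_{i,i}:=\lambda_i$, one has $x_{i,j}\ge x_{i,j+1}\ge x_{i+1,j+1}$ for all $1\le i\le j\le n-1$. For $w\in S_{n-1}$ and $j\in[n-1]$, let $r_j\in[1,n-j]$ be the integer such that $w^{-1}(j)$ is the $r_j$-th smallest integer among $w^{-1}(j),w^{-1}(j+1),\dots,w^{-1}(n-1)$. The face of $\mathrm{GZ}(\lambda)$ attached to $w$ is the subset cut out by the equations $x_{i,i+j}=x_{i,i+j-1}$ for $1\le i\le r_j-1$ and $x_{i,i+j}=x_{i+1,i+j}$ for $r_j+1\le i\le n-j$, for all $j=1,\dots,n-1$. Define $\Phi:\mathrm{GZ}(\lambda)\to\mathbb{R}^n$ by $\Phi(x)=(y_0-y_1,\,y_1-y_2,\dots,y_{n-2}-y_{n-1},\,y_{n-1})$, where $y_j=x_{1,1+j}+x_{2,2+j}+\cdots+x_{n-j,n}$ for $j=0,\dots,n-1$. In the claim, $\mathrm{GZ}(\lambda,w)\subset\mathbb{R}^n$ denotes the image under $\Phi$ of the face attached to $w$. *)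

theory Defs
  imports
    Complex_Main
    "HOL-Combinatorics.Permutations"
    "HOL-Library.FuncSet"
    "HOL-Library.Poly_Mapping"
    "Jordan_Normal_Form.DL_Rank"
    "Jordan_Normal_Form.DL_Submatrix"
begin

text \<open>
  Throughout, a permutation \<open>w \<in> S\<^sub>n\<^sub>-\<^sub>1\<close> is a function with \<open>w permutes {1..n-1}\<close>, and
  rows, columns, coordinates and parts of \<open>lam\<close> are numbered from 1 as in
  the mathematics.  Matrices and vectors of the library are numbered from 0, hence the shifts
  by one.  A sequence \<open>\<lambda>\<^sub>1, \<dots>, \<lambda>\<^sub>n\<close> is given by the values of \<open>lam :: nat \<Rightarrow> real\<close> on \<open>{1..n}\<close>,
  and \<open>\<real>\<^sup>n\<close> is \<open>carrier_vec n\<close>.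
\<close>

subsection \<open>Generic choices\<close>

text \<open>
  Multivariate polynomials with variables indexed by \<open>'v\<close>: finitely supported maps from
  exponent vectors to coefficients.
\<close>

definition mpoly_eval :: "(('v \<Rightarrow>\<^sub>0 nat) \<Rightarrow>\<^sub>0 complex) \<Rightarrow> ('v \<Rightarrow> complex) \<Rightarrow> complex" where
  "mpoly_eval p a =
     (\<Sum>m \<in> Poly_Mapping.keys p. Poly_Mapping.lookup p m *
        (\<Prod>v \<in> Poly_Mapping.keys m. a v ^ Poly_Mapping.lookup m v))"

text \<open>
  A property holds for generic values of the variables in \<open>V\<close> if it holds off the zero set of
  some nonzero polynomial in these variables, i.e. on a nonempty Zariski open set.  For finite
  \<open>V\<close> the polynomial may be multiplied by the product of the variables, so generic values may
  always be taken to be nonzero.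
\<close>

definition generically :: "'v set \<Rightarrow> (('v \<Rightarrow> complex) \<Rightarrow> bool) \<Rightarrow> bool" where
  "generically V P \<longleftrightarrow>
     (\<exists>p :: ('v \<Rightarrow>\<^sub>0 nat) \<Rightarrow>\<^sub>0 complex. p \<noteq> 0 \<and>
        (\<forall>m \<in> Poly_Mapping.keys p. Poly_Mapping.keys m \<subseteq> V) \<and>
        (\<forall>a. mpoly_eval p a \<noteq> 0 \<longrightarrow> P a))"

subsection \<open>The matrix of a permutation\<close>

definition star2_col :: "nat \<Rightarrow> (nat \<Rightarrow> nat) \<Rightarrow> nat \<Rightarrow> nat" where
  "star2_col n w i = (if i = n then 1 else inv_into UNIV w i + 1)"

text \<open>
  For \<open>1 \<le> i < n\<close> the set below is nonempty: column 1 receives its symbol \<open>\<star>\<^sub>2\<close> only in row \<open>n\<close>.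
\<close>

definition star1_col :: "nat \<Rightarrow> (nat \<Rightarrow> nat) \<Rightarrow> nat \<Rightarrow> nat" where
  "star1_col n w i =
     Max {c. 1 \<le> c \<and> c < star2_col n w i \<and> (\<forall>k. 1 \<le> k \<and> k < i \<longrightarrow> star2_col n w k \<noteq> c)}"

definition star_positions :: "nat \<Rightarrow> (nat \<Rightarrow> nat) \<Rightarrow> (nat \<times> nat) set" where
  "star_positions n w =
     (\<lambda>i. (i, star2_col n w i)) ` {1..n} \<union> (\<lambda>i. (i, star1_col n w i)) ` {1..n - 1}"

definition A_mat :: "nat \<Rightarrow> (nat \<Rightarrow> nat) \<Rightarrow> (nat \<times> nat \<Rightarrow> complex) \<Rightarrow> complex mat" where
  "A_mat n w a =
     mat n n (\<lambda>(i, j). if (Suc i, Suc j) \<in> star_positions n w then a (Suc i, Suc j) else 0)"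

subsection \<open>Weighted flag matroid polytopes\<close>

text \<open>The rank of the submatrix formed by the rows in \<open>S \<subseteq> {1..n}\<close> and the first \<open>j\<close> columns.\<close>

definition sub_rank :: "complex mat \<Rightarrow> nat set \<Rightarrow> nat \<Rightarrow> nat" where
  "sub_rank A S j = vec_space.rank (card S) (submatrix A {i. Suc i \<in> S} {..<j})"

definition FM :: "nat \<Rightarrow> (nat \<Rightarrow> real) \<Rightarrow> complex mat \<Rightarrow> real vec set" where
  "FM n lam A =
     {z \<in> carrier_vec n.
        (\<forall>i \<in> {1..n}. 0 \<le> z $ (i - 1)) \<and>
        (\<Sum>i = 1..n. z $ (i - 1)) = (\<Sum>i = 1..n. lam i) \<and>
        (\<forall>S \<subseteq> {1..n}. (\<Sum>i \<in> S. z $ (i - 1)) \<le>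
           (\<Sum>j = 1..n. (lam j - (if j = n then 0 else lam (j + 1))) * real (sub_rank A S j)))}"

subsection \<open>Gelfand--Zetlin faces\<close>

definition gz_entry :: "(nat \<Rightarrow> real) \<Rightarrow> (nat \<times> nat \<Rightarrow> real) \<Rightarrow> nat \<Rightarrow> nat \<Rightarrow> real" where
  "gz_entry lam x i j = (if i = j then lam i else x (i, j))"

definition GZ_polytope :: "nat \<Rightarrow> (nat \<Rightarrow> real) \<Rightarrow> (nat \<times> nat \<Rightarrow> real) set" where
  "GZ_polytope n lam =
     {x \<in> {(k, l). 1 \<le> k \<and> k < l \<and> l \<le> n} \<rightarrow>\<^sub>E UNIV.
        \<forall>i j. 1 \<le> i \<and> i \<le> j \<and> j \<le> n - 1 \<longrightarrow>
          gz_entry lam x i j \<ge> gz_entry lam x i (j + 1) \<and>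
          gz_entry lam x i (j + 1) \<ge> gz_entry lam x (i + 1) (j + 1)}"

definition gz_r :: "nat \<Rightarrow> (nat \<Rightarrow> nat) \<Rightarrow> nat \<Rightarrow> nat" where
  "gz_r n w j = card {v \<in> inv_into UNIV w ` {j..n - 1}. v \<le> inv_into UNIV w j}"

definition GZ_face :: "nat \<Rightarrow> (nat \<Rightarrow> real) \<Rightarrow> (nat \<Rightarrow> nat) \<Rightarrow> (nat \<times> nat \<Rightarrow> real) set" where
  "GZ_face n lam w =
     {x \<in> GZ_polytope n lam. \<forall>j \<in> {1..n - 1}.
        (\<forall>i. 1 \<le> i \<and> i + 1 \<le> gz_r n w j \<longrightarrow>
           gz_entry lam x i (i + j) = gz_entry lam x i (i + j - 1)) \<and>
        (\<forall>i. gz_r n w j + 1 \<le> i \<and> i \<le> n - j \<longrightarrow>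
           gz_entry lam x i (i + j) = gz_entry lam x (i + 1) (i + j))}"

definition gz_y :: "nat \<Rightarrow> (nat \<Rightarrow> real) \<Rightarrow> (nat \<times> nat \<Rightarrow> real) \<Rightarrow> nat \<Rightarrow> real" where
  "gz_y n lam x j = (\<Sum>i = 1..n - j. gz_entry lam x i (i + j))"

definition GZ_map :: "nat \<Rightarrow> (nat \<Rightarrow> real) \<Rightarrow> (nat \<times> nat \<Rightarrow> real) \<Rightarrow> real vec" where
  "GZ_map n lam x =
     vec n (\<lambda>m. if m = n - 1 then gz_y n lam x m else gz_y n lam x m - gz_y n lam x (m + 1))"

definition GZ :: "nat \<Rightarrow> (nat \<Rightarrow> real) \<Rightarrow> (nat \<Rightarrow> nat) \<Rightarrow> real vec set" where
  "GZ n lam w = GZ_map n lam ` GZ_face n lam w"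

end

theory Submission
  imports Defs
begin

text \<open>
  Row 1 of \<open>A\<^sub>w\<close> has its two nonzero entries in adjacent columns \<open>p\<close>, \<open>p + 1\<close>, and column \<open>p + 1\<close>
  vanishes below row 1.  Hence one elimination step expresses every rank \<open>rank (A\<^sub>S\<^sub>,\<^sub>j)\<close> by a rank of
  the matrix without row 1 and column \<open>p + 1\<close>; in particular the ranks only depend on the entries
  being nonzero.  Write \<open>u = \<lambda>\<^sub>p\<close>, \<open>v = \<lambda>\<^sub>p\<^sub>+\<^sub>1\<close>, let \<open>\<nu>(t)\<close> be \<open>\<lambda>\<close> with the two parts \<open>u, v\<close> merged into
  \<open>t\<close>, and let \<open>f\<close>, \<open>g\<^sub>t\<close> be the bounds defining the polytopes of \<open>\<lambda>\<close> and \<open>\<nu>(t)\<close>.  Then, for \<open>T\<close> not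
  containing 1, \<open>f(T) = g\<^sub>u(T)\<close> and \<open>f({1} \<union> T) = u + g\<^sub>v(T)\<close>, while \<open>g\<^sub>t(T)\<close> is affine in \<open>t\<close> with
  slope 0 or 1.  Therefore \<open>z\<close> lies in the polytope of \<open>\<lambda>\<close> iff \<open>v \<le> z\<^sub>1 \<le> u\<close> and
  \<open>(z\<^sub>2, \<dots>, z\<^sub>n)\<close> lies in that of \<open>\<nu>(u + v - z\<^sub>1)\<close>.  The same recursion describes the
  Gelfand--Zetlin face, since each diagonal of a pattern in it has a single free entry \<open>t\<close>,
  which ranges over \<open>[v, u]\<close>, and \<open>z\<^sub>1 = u + v - t\<close>.
\<close>

subsection \<open>Rank by elimination\<close>

text \<open>Columns are recorded by their labels rather than as vectors: two equal columns count as
  dependent, and rows or columns can be deleted without renumbering.\<close>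

definition col_indep :: "('r \<Rightarrow> 'c \<Rightarrow> 'a::field) \<Rightarrow> 'r set \<Rightarrow> 'c set \<Rightarrow> bool" where
  "col_indep e S J \<longleftrightarrow>
     (\<forall>q. (\<forall>i\<in>S. (\<Sum>j\<in>J. q j * e i j) = 0) \<longrightarrow> (\<forall>j\<in>J. q j = 0))"

text \<open>Rank as a relation, witnessed by a maximal independent set of columns. Each elimination
  step extends or keeps such a witness; \<open>rank_eq_has_rank\<close> identifies \<open>d\<close>
  with the matrix rank.\<close>

definition has_rank :: "('r \<Rightarrow> 'c \<Rightarrow> 'a::field) \<Rightarrow> 'r set \<Rightarrow> 'c set \<Rightarrow> nat \<Rightarrow> bool" where
  "has_rank e S K d \<longleftrightarrow>
     (\<exists>J\<subseteq>K. finite J \<and> card J = d \<and> col_indep e S J \<and>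
        (\<forall>j\<in>K - J. \<not> col_indep e S (insert j J)))"

lemma col_indepD:
  assumes "col_indep e S J" "\<And>i. i \<in> S \<Longrightarrow> (\<Sum>j\<in>J. q j * e i j) = 0" "j \<in> J"
  shows "q j = 0"
proof -
  have "\<forall>i\<in>S. (\<Sum>j\<in>J. q j * e i j) = 0" using assms(2) by (rule ballI)
  moreover have "(\<forall>i\<in>S. (\<Sum>j\<in>J. q j * e i j) = 0) \<longrightarrow> (\<forall>j\<in>J. q j = 0)"
    using assms(1) unfolding col_indep_def by (rule spec[of _ q])
  ultimately have "\<forall>j\<in>J. q j = 0" by (rule rev_mp)
  then show ?thesis using assms(3) by (rule bspec)
qed

lemma not_col_indepE:
  assumes "\<not> col_indep e S J"
  obtains q j where "\<And>i. i \<in> S \<Longrightarrow> (\<Sum>j\<in>J. q j * e i j) = 0" "j \<in> J" "q j \<noteq> 0"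
  using assms by (auto simp: col_indep_def)

lemma has_rankI:
  assumes "J \<subseteq> K" "finite J" "card J = d" "col_indep e S J"
    "\<And>j. j \<in> K - J \<Longrightarrow> \<not> col_indep e S (insert j J)"
  shows "has_rank e S K d"
  unfolding has_rank_def using assms by (intro exI[of _ J]) simp

lemma has_rank_empty: "has_rank e S {} 0"
  by (auto simp: has_rank_def col_indep_def)

lemma not_col_indep_insert_zero:
  fixes e :: "'r \<Rightarrow> 'c \<Rightarrow> 'a::field"
  assumes "finite J" "c \<notin> J" "\<forall>i\<in>S. e i c = 0"
  shows "\<not> col_indep e S (insert c J)"
proof -
  define q where "q j = (if j = c then 1 else 0 :: 'a)" for j
  have "(\<Sum>j\<in>insert c J. q j * e i j) = 0" if "i \<in> S" for i
    using assms that by (intro sum.neutral) (auto simp: q_def)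
  moreover have "q c \<noteq> 0" by (simp add: q_def)
  ultimately show ?thesis
    using col_indepD[of e S "insert c J" q c] by auto
qed

lemma has_rank_zero_col:
  assumes "\<forall>i\<in>S. e i c = 0" "has_rank e S (K - {c}) d"
  shows "has_rank e S K d"
proof -
  obtain J where J: "J \<subseteq> K - {c}" "finite J" "card J = d" "col_indep e S J"
      "\<forall>j\<in>K - {c} - J. \<not> col_indep e S (insert j J)"
    using assms(2) by (auto simp: has_rank_def)
  have "\<not> col_indep e S (insert j J)" if "j \<in> K - J" for j
    using J that not_col_indep_insert_zero[of J c S e] assms(1) by (cases "j = c") auto
  then show ?thesis
    using J by (intro has_rankI[of J]) auto
qed

lemma has_rank_zero_row:
  assumes "\<forall>j\<in>K. e i j = 0" "has_rank e S K d"
  shows "has_rank e (insert i S) K d"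
proof -
  have eq: "col_indep e (insert i S) J \<longleftrightarrow> col_indep e S J" if "J \<subseteq> K" for J
  proof -
    have "(\<Sum>j\<in>J. q j * e i j) = 0" for q
      using assms(1) that by (intro sum.neutral) auto
    then show ?thesis by (simp add: col_indep_def)
  qed
  obtain J where J: "J \<subseteq> K" "finite J" "card J = d" "col_indep e S J"
      "\<forall>j\<in>K - J. \<not> col_indep e S (insert j J)"
    using assms(2) by (auto simp: has_rank_def)
  then show ?thesis
    using eq by (intro has_rankI[of J]) auto
qed

text \<open>Column \<open>c\<close> meets only row \<open>i\<close>, so its coefficient does not
  enter the equations of \<open>S\<close> and can be chosen freely to satisfy the equation of row
  \<open>i\<close>.\<close>

lemma has_rank_pivot_col:
  assumes "c \<in> K" "e i c \<noteq> 0" "\<forall>k\<in>S. e k c = 0" "has_rank e S (K - {c}) d"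
  shows "has_rank e (insert i S) K (Suc d)"
proof -
  obtain J where J: "J \<subseteq> K - {c}" "finite J" "card J = d" "col_indep e S J"
      and max: "\<forall>j\<in>K - {c} - J. \<not> col_indep e S (insert j J)"
    using assms(4) by (auto simp: has_rank_def)
  have c: "c \<notin> J" using J by auto
  have "col_indep e (insert i S) (insert c J)"
    unfolding col_indep_def
  proof (intro allI impI)
    fix q assume q: "\<forall>k\<in>insert i S. (\<Sum>j\<in>insert c J. q j * e k j) = 0"
    have split: "q c * e k c + (\<Sum>j\<in>J. q j * e k j) = 0" if "k \<in> insert i S" for k
      using bspec[OF q that] by (simp only: sum.insert[OF J(2) c])
    have "(\<Sum>j\<in>J. q j * e k j) = 0" if "k \<in> S" for k
      using split[of k] assms(3) that by simp
    then have J0: "\<forall>j\<in>J. q j = 0" using col_indepD[OF J(4)] by blast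
    then have "q c * e i c = 0" using split[of i] by simp
    then show "\<forall>j\<in>insert c J. q j = 0" using J0 assms(2) by auto
  qed
  moreover have "\<not> col_indep e (insert i S) (insert l (insert c J))" if "l \<in> K - insert c J" for l
  proof -
    have l: "l \<noteq> c" "l \<notin> J" using that by auto
    have "\<not> col_indep e S (insert l J)" using max that by blast
    then obtain q l' where q: "\<And>k. k \<in> S \<Longrightarrow> (\<Sum>j\<in>insert l J. q j * e k j) = 0"
        "l' \<in> insert l J" "q l' \<noteq> 0"
      by (rule not_col_indepE) blast
    \<comment> \<open>The coefficient at \<open>c\<close> is the one that solves the equation of row
      \<open>i\<close>.\<close>
    define q' where "q' = q(c := - (\<Sum>j\<in>insert l J. q j * e i j) / e i c)"
    have same: "(\<Sum>j\<in>insert l J. q' j * e k j) = (\<Sum>j\<in>insert l J. q j * e k j)" for k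
      using c l by (intro sum.cong) (auto simp: q'_def)
    have sum: "(\<Sum>j\<in>insert c (insert l J). q' j * e k j) =
        q' c * e k c + (\<Sum>j\<in>insert l J. q j * e k j)" for k
      using c l J(2) unfolding same[symmetric] by (subst sum.insert) auto
    have zero: "(\<Sum>j\<in>insert c (insert l J). q' j * e k j) = 0" if "k \<in> insert i S" for k
    proof (cases "k = i")
      case True
      show ?thesis unfolding sum using True assms(2) by (simp add: q'_def)
    next
      case False
      show ?thesis unfolding sum using False q(1)[of k] assms(3) that by simp
    qed
    have l': "l' \<in> insert c (insert l J)" "q' l' \<noteq> 0"
      using q(2,3) l c by (auto simp: q'_def)
    show ?thesis
      unfolding insert_commute[of l c]
    proof
      assume ind: "col_indep e (insert i S) (insert c (insert l J))"
      show False using col_indepD[OF ind zero l'(1)] l'(2) by simp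
    qed
  qed
  moreover have "insert c J \<subseteq> K" using J(1) assms(1) by auto
  moreover have "card (insert c J) = Suc d" using J(2,3) c by simp
  ultimately show ?thesis
    using J(2) by (intro has_rankI[of "insert c J"]) simp_all
qed

text \<open>The equation of row \<open>i\<close> forces the coefficient at \<open>p\<close> to
  vanish; what remains is the system without row \<open>i\<close> and column
  \<open>p\<close>.\<close>

lemma has_rank_pivot_row:
  assumes "p \<in> K" "e i p \<noteq> 0" "\<forall>j\<in>K - {p}. e i j = 0" "has_rank e S (K - {p}) d"
  shows "has_rank e (insert i S) K (Suc d)"
proof -
  obtain J where J: "J \<subseteq> K - {p}" "finite J" "card J = d" "col_indep e S J"
      and max: "\<forall>j\<in>K - {p} - J. \<not> col_indep e S (insert j J)"
    using assms(4) by (auto simp: has_rank_def)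
  have p: "p \<notin> J" using J by auto
  have row: "(\<Sum>j\<in>L. q j * e i j) = 0" if "L \<subseteq> K - {p}" for q L
    using that assms(3) by (intro sum.neutral) auto
  have "col_indep e (insert i S) (insert p J)"
    unfolding col_indep_def
  proof (intro allI impI)
    fix q assume q: "\<forall>k\<in>insert i S. (\<Sum>j\<in>insert p J. q j * e k j) = 0"
    have split: "q p * e k p + (\<Sum>j\<in>J. q j * e k j) = 0" if "k \<in> insert i S" for k
      using bspec[OF q that] by (simp only: sum.insert[OF J(2) p])
    have p0: "q p = 0" using split[of i] row[OF J(1), of q] assms(2) by simp
    then have "(\<Sum>j\<in>J. q j * e k j) = 0" if "k \<in> S" for k
      using split[of k] that by simp
    then have "\<forall>j\<in>J. q j = 0" using col_indepD[OF J(4)] by blast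
    then show "\<forall>j\<in>insert p J. q j = 0" using p0 by simp
  qed
  moreover have "\<not> col_indep e (insert i S) (insert l (insert p J))" if "l \<in> K - insert p J" for l
  proof -
    have l: "l \<noteq> p" "l \<notin> J" using that by auto
    have "\<not> col_indep e S (insert l J)" using max that by blast
    then obtain q l' where q: "\<And>k. k \<in> S \<Longrightarrow> (\<Sum>j\<in>insert l J. q j * e k j) = 0"
        "l' \<in> insert l J" "q l' \<noteq> 0"
      by (rule not_col_indepE) blast
    \<comment> \<open>The relation \<open>q\<close> is unconstrained outside
      \<open>insert l J\<close>, so its value at \<open>p\<close> is reset to 0.\<close>
    define q' where "q' = q(p := 0)"
    have same: "(\<Sum>j\<in>insert l J. q' j * e k j) = (\<Sum>j\<in>insert l J. q j * e k j)" for k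
      using p l by (intro sum.cong) (auto simp: q'_def)
    have sum: "(\<Sum>j\<in>insert p (insert l J). q' j * e k j) = (\<Sum>j\<in>insert l J. q j * e k j)" for k
      using p l J(2) unfolding same[symmetric] by (subst sum.insert) (auto simp: q'_def)
    have "insert l J \<subseteq> K - {p}" using J(1) that by auto
    then have zero: "(\<Sum>j\<in>insert p (insert l J). q' j * e k j) = 0" if "k \<in> insert i S" for k
      unfolding sum using q(1)[of k] row[of "insert l J" q] that by auto
    have l': "l' \<in> insert p (insert l J)" "q' l' \<noteq> 0"
      using q(2,3) l p by (auto simp: q'_def)
    show ?thesis
      unfolding insert_commute[of l p]
    proof
      assume ind: "col_indep e (insert i S) (insert p (insert l J))"
      show False using col_indepD[OF ind zero l'(1)] l'(2) by simp
    qed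
  qed
  moreover have "insert p J \<subseteq> K" using J(1) assms(1) by auto
  moreover have "card (insert p J) = Suc d" using J(2,3) p by simp
  ultimately show ?thesis
    using J(2) by (intro has_rankI[of "insert p J"]) simp_all
qed

section \<open>From labelled columns to the rank of matrices and submatrices\<close>

text \<open>Injectivity of \<open>v\<close> keeps equal columns from collapsing to one vector of the
  image, so coefficients on labels and on vectors correspond.\<close>

lemma (in vec_space) lin_indpt_image_iff_col_indep:
  assumes "finite J" "inj_on v J" "v ` J \<subseteq> carrier_vec n"
    and e: "\<And>i j. i < n \<Longrightarrow> j \<in> J \<Longrightarrow> v j $ i = e i j"
  shows "lin_indpt (v ` J) \<longleftrightarrow> col_indep e {..<n} J"
proof -
  have comb: "lincomb q (v ` J) = 0\<^sub>v n \<longleftrightarrow> (\<forall>i<n. (\<Sum>j\<in>J. q (v j) * e i j) = 0)" for q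
  proof -
    have dim: "lincomb q (v ` J) \<in> carrier_vec n"
      using assms by (intro lincomb_closed) auto
    have "lincomb q (v ` J) $ i = (\<Sum>j\<in>J. q (v j) * e i j)" if "i < n" for i
      using that assms by (simp add: lincomb_index sum.reindex)
    then show ?thesis
      using dim by (auto simp: vec_eq_iff)
  qed
  show ?thesis
  proof
    assume ind: "lin_indpt (v ` J)"
    show "col_indep e {..<n} J"
      unfolding col_indep_def
    proof (intro allI impI ballI)
      fix q j assume q: "\<forall>i\<in>{..<n}. (\<Sum>j\<in>J. q j * e i j) = 0" and j: "j \<in> J"
      define q' where "q' = q \<circ> the_inv_into J v"
      have q': "q' (v j) = q j" if "j \<in> J" for j
        using that assms(2) by (simp add: q'_def the_inv_into_f_f)
      have "lincomb q' (v ` J) = 0\<^sub>v n"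
        using q by (auto simp: comb q')
      then have "q' \<in> v ` J \<rightarrow> {0}"
        using not_lindepD[OF ind _ subset_refl, of q'] assms(1) by auto
      then have "q' (v j) = 0" using j by auto
      then show "q j = 0" using q'[OF j] by simp
    qed
  next
    assume ind: "col_indep e {..<n} J"
    show "lin_indpt (v ` J)"
    proof (rule finite_lin_indpt2)
      fix q assume "lincomb q (v ` J) = 0\<^sub>v n"
      then have "\<forall>i<n. (\<Sum>j\<in>J. q (v j) * e i j) = 0" using comb by simp
      then have "(q \<circ> v) j = 0" if "j \<in> J" for j
        using that by (intro col_indepD[OF ind, of "q \<circ> v" j]) simp_all
      then show "\<forall>u\<in>v ` J. q u = 0" by simp
    qed (use assms in auto)
  qed
qed

lemma (in vec_space) rank_eq_has_rank:
  assumes A: "A \<in> carrier_mat n nc" and d: "has_rank (\<lambda>i j. A $$ (i, j)) {..<n} {..<nc} d"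
  shows "rank A = d"
proof -
  let ?e = "\<lambda>i j. A $$ (i, j)"
  obtain J where J: "J \<subseteq> {..<nc}" "finite J" "card J = d" "col_indep ?e {..<n} J"
      and max: "\<forall>j\<in>{..<nc} - J. \<not> col_indep ?e {..<n} (insert j J)"
    using d by (auto simp: has_rank_def)
  have cols: "set (cols A) = col A ` {..<nc}"
    using A by (auto simp: cols_def)
  have idx: "col A j $ i = A $$ (i, j)" if "i < n" "j < nc" for i j
    using that A by auto
  have inj: "inj_on (col A) J"
  proof (rule inj_onI, rule ccontr)
    fix j l assume jl: "j \<in> J" "l \<in> J" "col A j = col A l" "j \<noteq> l"
    \<comment> \<open>Equal columns at distinct labels would give the nontrivial relation with
      coefficients 1 and -1.\<close>
    define q where "q = (\<lambda>x. (if x = j then 1 else 0) - (if x = l then 1 else 0 :: 'a))"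
    have "(\<Sum>x\<in>J. q x * ?e i x) = 0" if "i < n" for i
    proof -
      have "(\<Sum>x\<in>J. q x * ?e i x) =
          (\<Sum>x\<in>J. (if x = j then ?e i x else 0) - (if x = l then ?e i x else 0))"
        by (intro sum.cong) (auto simp: q_def)
      also have "\<dots> = ?e i j - ?e i l"
        using jl J(2) by (simp add: sum_subtractf)
      also have "\<dots> = 0"
        using jl J(1) that idx[of i j] idx[of i l] by (auto simp: subset_eq)
      finally show ?thesis .
    qed
    then have "q j = 0" by (rule col_indepD[OF J(4) _ jl(1)]) simp
    then show False using jl by (simp add: q_def)
  qed
  have iff: "lin_indpt (col A ` L) \<longleftrightarrow> col_indep ?e {..<n} L"
    if "L \<subseteq> {..<nc}" "inj_on (col A) L" for L
    using that A idx by (intro lin_indpt_image_iff_col_indep) (auto intro: finite_subset)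
  have "maximal (col A ` J) (\<lambda>T. T \<subseteq> set (cols A) \<and> lin_indpt T)"
    unfolding maximal_def
  proof (intro conjI allI impI)
    show "col A ` J \<subseteq> set (cols A)" using J cols by auto
    show "lin_indpt (col A ` J)" using iff[OF J(1) inj] J(4) by simp
    fix T assume T: "col A ` J \<subseteq> T \<and> T \<subseteq> set (cols A) \<and> lin_indpt T"
    show "T = col A ` J"
    proof (rule ccontr)
      assume "T \<noteq> col A ` J"
      \<comment> \<open>A larger independent set of columns contains one outside the image of
        \<open>J\<close>; its label would enlarge \<open>J\<close>, against maximality.\<close>
      then obtain l where l: "l < nc" "col A l \<in> T" "col A l \<notin> col A ` J"
        using T unfolding cols by blast
      then have "lin_indpt (col A ` insert l J)"
        using T supset_ld_is_ld[of "col A ` insert l J" T] by auto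
      moreover have "inj_on (col A) (insert l J)" using inj l by auto
      ultimately have "col_indep ?e {..<n} (insert l J)"
        using iff[of "insert l J"] l J by auto
      then show False using max l by auto
    qed
  qed
  then have "rank A = card (col A ` J)" using rank_card_indpt[OF A] by blast
  then show ?thesis using J inj by (simp add: card_image)
qed

text \<open>Serves to pass to submatrices, whose rows and columns are renumbered from 0; relabelling
  carries column relations over unchanged.\<close>

lemma has_rank_reindex:
  assumes f: "bij_betw f S' S" and d: "has_rank e S K d"
    and e: "\<And>i j. i \<in> S' \<Longrightarrow> j \<in> K' \<Longrightarrow> e' i j = e (f i) (g j)" and g: "bij_betw g K' K"
  shows "has_rank e' S' K' d"
proof -
  have iff: "col_indep e' S' L \<longleftrightarrow> col_indep e S (g ` L)" if L: "L \<subseteq> K'" for L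
  proof -
    have inj: "inj_on g L" using g L by (auto simp: bij_betw_def inj_on_subset)
    have rows: "(\<forall>i\<in>S. P i) \<longleftrightarrow> (\<forall>i\<in>S'. P (f i))" for P
      using f by (auto simp: bij_betw_def)
    have s: "(\<Sum>j\<in>L. q (g j) * e' i j) = (\<Sum>j\<in>g ` L. q j * e (f i) j)" if "i \<in> S'" for q i
      using that L e inj by (simp add: sum.reindex subset_eq)
    show ?thesis
    proof
      assume l: "col_indep e' S' L"
      show "col_indep e S (g ` L)"
        unfolding col_indep_def rows
      proof (intro allI impI)
        fix q assume "\<forall>i\<in>S'. (\<Sum>j\<in>g ` L. q j * e (f i) j) = 0"
        then have "(\<Sum>j\<in>L. (q \<circ> g) j * e' i j) = 0" if "i \<in> S'" for i
          using that by (simp add: s)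
        then have "(q \<circ> g) j = 0" if "j \<in> L" for j
          using that by (intro col_indepD[OF l, of "q \<circ> g" j]) simp_all
        then show "\<forall>j\<in>g ` L. q j = 0" by simp
      qed
    next
      assume r: "col_indep e S (g ` L)"
      show "col_indep e' S' L"
        unfolding col_indep_def
      proof (intro allI impI)
        fix q assume q: "\<forall>i\<in>S'. (\<Sum>j\<in>L. q j * e' i j) = 0"
        define q' where "q' = q \<circ> the_inv_into L g"
        have q': "q' (g j) = q j" if "j \<in> L" for j
          using that inj by (simp add: q'_def the_inv_into_f_f)
        have "\<forall>i\<in>S'. (\<Sum>j\<in>g ` L. q' j * e (f i) j) = 0"
          using q by (simp add: s[symmetric] q')
        then have "\<forall>i\<in>S. (\<Sum>j\<in>g ` L. q' j * e i j) = 0" by (simp only: rows)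
        then have "\<forall>j\<in>g ` L. q' j = 0" using col_indepD[OF r] by blast
        then show "\<forall>j\<in>L. q j = 0" by (simp add: q')
      qed
    qed
  qed
  obtain J where J: "J \<subseteq> K" "finite J" "card J = d" "col_indep e S J"
      "\<forall>j\<in>K - J. \<not> col_indep e S (insert j J)"
    using d by (auto simp: has_rank_def)
  define L where "L = {j\<in>K'. g j \<in> J}"
  have L: "L \<subseteq> K'" "g ` L = J" using J(1) g by (auto simp: L_def bij_betw_def)
  have inj: "inj_on g L" using g L by (auto simp: bij_betw_def inj_on_subset)
  have "\<not> col_indep e' S' (insert j L)" if "j \<in> K' - L" for j
  proof -
    have "g j \<in> K - J" using that g by (auto simp: L_def bij_betw_def)
    then show ?thesis using J(5) L iff[of "insert j L"] that by auto
  qed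
  moreover have "finite L" "card L = d"
    using J L inj by (auto simp: finite_image_iff card_image dest: sym)
  ultimately show ?thesis
    using L iff[OF L(1)] J(4) by (intro has_rankI[of L]) simp_all
qed

lemma bij_betw_pick:
  assumes "finite I"
  shows "bij_betw (pick I) {..<card I} I"
proof (rule bij_betw_imageI)
  show "inj_on (pick I) {..<card I}"
  proof (rule linorder_inj_onI)
    fix i j :: nat assume "i < j" "i \<in> {..<card I}" "j \<in> {..<card I}"
    then show "pick I i \<noteq> pick I j" using pick_mono_le[of j I i] by simp
  qed auto
  show "pick I ` {..<card I} = I"
  proof
    show "pick I ` {..<card I} \<subseteq> I" using pick_in_set_le by auto
    show "I \<subseteq> pick I ` {..<card I}"
    proof
      fix i assume i: "i \<in> I"
      \<comment> \<open>The preimage of \<open>i\<close> under the increasing enumeration is the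
        number of smaller elements of \<open>I\<close>.\<close>
      then have "card {a\<in>I. a < i} < card I"
        using assms by (intro psubset_card_mono) auto
      then show "i \<in> pick I ` {..<card I}"
        using pick_card_in_set[OF i] by (intro image_eqI[of i _ "card {a\<in>I. a < i}"]) auto
    qed
  qed
qed

lemma sub_rank_eqI:
  assumes A: "A \<in> carrier_mat n n" and S: "S \<subseteq> {1..n}" and k: "k \<le> n"
    and d: "has_rank (\<lambda>i j. A $$ (i - 1, j - 1)) S {1..k} d"
  shows "sub_rank A S k = d"
proof -
  define I where "I = {i. Suc i \<in> S}"
  have SI: "S = Suc ` I"
  proof
    show "S \<subseteq> Suc ` I"
    proof
      fix i assume i: "i \<in> S"
      then have "i = Suc (i - 1)" using S by auto
      then show "i \<in> Suc ` I" using i by (auto simp: I_def image_iff intro!: exI[of _ "i - 1"])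
    qed
  qed (auto simp: I_def)
  then have cardI: "card I = card S" by (simp add: card_image)
  have "I \<subseteq> {..<n}" using S by (auto simp: I_def)
  then have finI: "finite I" by (rule finite_subset) simp
  have rows: "{i. i < dim_row A \<and> i \<in> I} = I" using A S SI by auto
  have cols: "{j. j < dim_col A \<and> j \<in> {..<k}} = {..<k}" using A k by auto
  have pick_k: "pick {..<k} j = j" if "j < k" for j
    using pick_card_in_set[of j "{..<k}"] that by (simp add: Collect_conj_eq lessThan_def[symmetric] Int_absorb1)
  have "has_rank (\<lambda>i j. submatrix A I {..<k} $$ (i, j)) {..<card S} {..<k} d"
  \<comment> \<open>\<open>pick I\<close> turns a row number of the submatrix into a row index of
    \<open>A\<close>, and \<open>Suc\<close> turns that into a label counted from 1.\<close>
  proof (rule has_rank_reindex[OF _ d, where f = "Suc \<circ> pick I" and g = Suc])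
    show "bij_betw (Suc \<circ> pick I) {..<card S} S"
      using bij_betw_trans[OF bij_betw_pick[OF finI], of Suc S] SI cardI
      by (simp add: bij_betw_def)
    show "bij_betw Suc {..<k} {1..k}"
      by (auto simp: bij_betw_def image_Suc_lessThan)
    fix i j assume "i \<in> {..<card S}" "j \<in> {..<k}"
    then show "submatrix A I {..<k} $$ (i, j) = A $$ ((Suc \<circ> pick I) i - 1, Suc j - 1)"
      by (subst submatrix_index) (simp_all only: rows cols cardI, simp_all add: pick_k)
  qed
  moreover have "submatrix A I {..<k} \<in> carrier_mat (card S) k"
    unfolding carrier_mat_def using dim_submatrix[of A I "{..<k}"]
    by (simp only: rows cols cardI) simp
  ultimately show ?thesis
    unfolding sub_rank_def I_def[symmetric] by (intro vec_space.rank_eq_has_rank)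
qed

subsection \<open>The recursion for the polytopes\<close>

text \<open>
  With \<open>r i\<close> the position of \<open>\<star>\<^sub>1\<close> in row \<open>i\<close> among the columns not removed by earlier rows, this is the
  rank of the rows \<open>S \<subseteq> {n - m<..n}\<close> on the first \<open>k\<close> of the \<open>m\<close> columns left after \<open>n - m\<close> steps.
\<close>

fun stage_rank :: "(nat \<Rightarrow> nat) \<Rightarrow> nat \<Rightarrow> nat \<Rightarrow> nat set \<Rightarrow> nat \<Rightarrow> nat" where
  "stage_rank r n 0 S k = 0"
| "stage_rank r n (Suc m) S k =
     (if n - m \<in> S
      then if k < r (n - m) then stage_rank r n m S k else Suc (stage_rank r n m S (k - 1))
      else stage_rank r n m S (if k \<le> r (n - m) then k else k - 1))"

declare stage_rank.simps(2) [simp del]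

lemma stage_rank_cong:
  assumes "\<And>i. n - m < i \<Longrightarrow> i \<le> n \<Longrightarrow> i \<in> S \<longleftrightarrow> i \<in> T" "m \<le> n"
  shows "stage_rank r n m S k = stage_rank r n m T k"
  using assms
proof (induction m arbitrary: k)
  case (Suc m)
  have "\<And>k. stage_rank r n m S k = stage_rank r n m T k"
    using Suc.prems by (intro Suc.IH) auto
  moreover have "n - m \<in> S \<longleftrightarrow> n - m \<in> T" using Suc.prems by auto
  ultimately show ?case by (simp add: stage_rank.simps)
qed simp

lemma stage_rank_empty: "stage_rank r n m {} k = 0"
  by (induction m arbitrary: k) (auto simp: stage_rank.simps)

lemma stage_rank_zero:
  assumes "\<And>i. 1 \<le> i \<Longrightarrow> i \<le> n \<Longrightarrow> 1 \<le> r i" "m \<le> n"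
  shows "stage_rank r n m S 0 = 0"
  using assms(2)
proof (induction m)
  case (Suc m)
  then have "1 \<le> r (n - m)" by (intro assms(1)) auto
  then show ?case using Suc by (auto simp: stage_rank.simps)
qed simp

text \<open>One more column raises a rank by 0 or 1. The recursion changes its branch only around
  \<open>k = r (n - m)\<close>, hence the cases of \<open>k\<close> and \<open>Suc k\<close> both
  before, at, or after the pivot.\<close>

lemma stage_rank_Suc_bounds:
  assumes "\<And>i. 1 \<le> i \<Longrightarrow> i \<le> n \<Longrightarrow> 1 \<le> r i" "m \<le> n"
  shows "stage_rank r n m S k \<le> stage_rank r n m S (Suc k) \<and>
         stage_rank r n m S (Suc k) \<le> Suc (stage_rank r n m S k)"
  using assms(2)
proof (induction m arbitrary: k)
  case (Suc m)
  have r: "1 \<le> r (n - m)" using Suc.prems by (intro assms(1)) auto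
  have IH: "stage_rank r n m S k \<le> stage_rank r n m S (Suc k) \<and>
         stage_rank r n m S (Suc k) \<le> Suc (stage_rank r n m S k)" for k
    using Suc by simp
  consider "Suc k < r (n - m)" | "Suc k = r (n - m)" | k' where "k = Suc k'" "r (n - m) \<le> k"
    using r by (cases k; cases "Suc k" "r (n - m)" rule: linorder_cases) auto
  then show ?case
  proof cases
    case 1
    then show ?thesis using IH[of k] by (simp add: stage_rank.simps)
  next
    case 2
    show ?thesis using IH[of k] by (simp add: stage_rank.simps flip: 2)
  next
    case 3
    then show ?thesis using IH[of k'] by (auto simp: stage_rank.simps)
  qed
qed simp

text \<open>Nonsingularity in combinatorial form: with \<open>r (n - m)\<close> at most the number
  of columns left afterwards, the elimination never runs out of columns.\<close>

lemma stage_rank_full: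
  assumes "\<And>i. 1 \<le> i \<Longrightarrow> i < n \<Longrightarrow> 1 \<le> r i \<and> r i \<le> n - i" "r n = 1"
    and "m \<le> n" "k \<le> m" "{n - m<..n} \<subseteq> S"
  shows "stage_rank r n m S k = k"
  using assms(3-5)
proof (induction m arbitrary: k)
  case (Suc m)
  have "{n - m<..n} \<subseteq> {n - Suc m<..n}" by auto
  then have IH: "k \<le> m \<Longrightarrow> stage_rank r n m S k = k" for k
    using Suc.prems by (intro Suc.IH) auto
  have "n - m \<in> S" using Suc.prems by auto
  \<comment> \<open>The maximum with 1 covers row \<open>n\<close>, where \<open>r n = 1\<close>
    although no column is left afterwards.\<close>
  moreover have "1 \<le> r (n - m) \<and> r (n - m) \<le> max 1 m"
    using Suc.prems assms(1)[of "n - m"] assms(2) by (cases "m = 0") auto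
  ultimately show ?case
    using IH[of k] IH[of "k - 1"] Suc.prems by (auto simp: stage_rank.simps)
qed simp

text \<open>The bound of the weighted flag matroid polytope after summation by parts: each part is
  weighted by a rank increment, which is what one elimination step controls.\<close>

definition flag_bound :: "(nat \<Rightarrow> nat) \<Rightarrow> nat \<Rightarrow> nat \<Rightarrow> (nat \<Rightarrow> real) \<Rightarrow> nat set \<Rightarrow> real" where
  "flag_bound r n m \<mu> S =
     (\<Sum>k = 1..m. \<mu> k * (real (stage_rank r n m S k) - real (stage_rank r n m S (k - 1))))"

definition stage_polytope :: "(nat \<Rightarrow> nat) \<Rightarrow> nat \<Rightarrow> nat \<Rightarrow> (nat \<Rightarrow> real) \<Rightarrow> (nat \<Rightarrow> real) set" where
  "stage_polytope r n m \<mu> =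
     {z. (\<forall>i\<in>{n - m<..n}. 0 \<le> z i) \<and> sum z {n - m<..n} = (\<Sum>k = 1..m. \<mu> k) \<and>
         (\<forall>S\<subseteq>{n - m<..n}. sum z S \<le> flag_bound r n m \<mu> S)}"

text \<open>The sequence \<nu>(t), for parts \<open>p\<close> and \<open>p + 1\<close> merged into
  \<open>t\<close>.\<close>

definition merge_at :: "nat \<Rightarrow> real \<Rightarrow> (nat \<Rightarrow> real) \<Rightarrow> nat \<Rightarrow> real" where
  "merge_at p t \<mu> k = (if k < p then \<mu> k else if k = p then t else \<mu> (Suc k))"

lemma sum_split_at:
  fixes f :: "nat \<Rightarrow> 'a::comm_monoid_add"
  assumes "1 \<le> p" "p \<le> m"
  shows "(\<Sum>k = 1..m. f k) = (\<Sum>k = 1..<p. f k) + f p + (\<Sum>k = Suc p..m. f k)"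
proof -
  have "{1..m} = {1..<p} \<union> ({p} \<union> {Suc p..m})" using assms by auto
  then have "(\<Sum>k = 1..m. f k) = sum f ({1..<p} \<union> ({p} \<union> {Suc p..m}))" by simp
  also have "\<dots> = sum f {1..<p} + (f p + sum f {Suc p..m})"
    by (subst sum.union_disjoint, auto)+
  finally show ?thesis by (simp add: add.assoc)
qed

text \<open>The last block is shifted by one so that it aligns termwise with the last block of
  \<open>sum_split_at\<close>, where one part fewer is summed.\<close>

lemma sum_split_at_Suc:
  fixes f :: "nat \<Rightarrow> 'a::comm_monoid_add"
  assumes "1 \<le> p" "p \<le> m"
  shows "(\<Sum>k = 1..Suc m. f k) =
         (\<Sum>k = 1..<p. f k) + f p + (f (Suc p) + (\<Sum>k = Suc p..m. f (Suc k)))"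
proof -
  have "(\<Sum>k = Suc p..Suc m. f k) = f (Suc p) + (\<Sum>k = Suc (Suc p)..Suc m. f k)"
    using assms by (intro sum.atLeast_Suc_atMost) auto
  then show ?thesis
    using assms sum_split_at[of p "Suc m" f] sum.shift_bounds_cl_Suc_ivl[of f "Suc p" m] by simp
qed

lemma sum_merge_at:
  assumes "1 \<le> p" "p \<le> m"
  shows "(\<Sum>k = 1..m. merge_at p t \<mu> k) = (\<Sum>k = 1..Suc m. \<mu> k) - \<mu> p - \<mu> (Suc p) + t"
  unfolding sum_split_at[OF assms] sum_split_at_Suc[OF assms]
  by (simp add: merge_at_def cong: sum.cong_simp)

section \<open>One elimination step for the polytopes\<close>

context
  fixes r :: "nat \<Rightarrow> nat" and n m p :: nat
  assumes r: "\<And>i. 1 \<le> i \<Longrightarrow> i < n \<Longrightarrow> 1 \<le> r i \<and> r i \<le> n - i" and rn: "r n = 1"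
    and m: "1 \<le> m" "m < n" and p_eq: "p = r (n - m)"
begin

text \<open>At \<open>k = p\<close> this is the slope of the bound as an affine function of the
  merged part.\<close>

abbreviation "rank_step S k \<equiv> real (stage_rank r n m S k) - real (stage_rank r n m S (k - 1))"

lemma pivot_range: "1 \<le> p" "p \<le> m"
  using r[of "n - m"] m p_eq by auto

lemma pivot_pos_ge_1: "1 \<le> i \<Longrightarrow> i \<le> n \<Longrightarrow> 1 \<le> r i"
  using r[of i] rn by (cases "i = n") auto

lemma rank_step_bounds: "0 \<le> rank_step S p" "rank_step S p \<le> 1"
  using stage_rank_Suc_bounds[of n r m S "p - 1"] pivot_pos_ge_1 m pivot_range by simp_all

lemma rank_step_cases: "rank_step S p = 0 \<or> rank_step S p = 1"
proof -
  have "stage_rank r n m S p = stage_rank r n m S (p - 1) \<or>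
        stage_rank r n m S p = Suc (stage_rank r n m S (p - 1))"
    using stage_rank_Suc_bounds[of n r m S "p - 1"] pivot_pos_ge_1 m pivot_range by simp linarith
  then show ?thesis by auto
qed

lemma flag_bound_merge_at:
  "flag_bound r n m (merge_at p t \<mu>) S =
     (\<Sum>k = 1..<p. \<mu> k * rank_step S k) + t * rank_step S p + (\<Sum>k = Suc p..m. \<mu> (Suc k) * rank_step S k)"
  unfolding flag_bound_def sum_split_at[OF pivot_range] by (simp add: merge_at_def cong: sum.cong_simp)

text \<open>Without row \<open>n - m\<close> the column \<open>p + 1\<close> adds no rank, so
  \<mu>(p+1) drops out and \<mu>(p) takes the merged slot.\<close>

lemma flag_bound_notin:
  assumes "n - m \<notin> S"
  shows "flag_bound r n (Suc m) \<mu> S = flag_bound r n m (merge_at p (\<mu> p) \<mu>) S"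
proof -
  have "(\<Sum>k = 1..<p. \<mu> k * (real (stage_rank r n (Suc m) S k) - real (stage_rank r n (Suc m) S (k - 1))))
      = (\<Sum>k = 1..<p. \<mu> k * rank_step S k)"
    using assms by (intro sum.cong) (auto simp: stage_rank.simps p_eq)
  moreover have "(\<Sum>k = Suc p..m. \<mu> (Suc k) *
        (real (stage_rank r n (Suc m) S (Suc k)) - real (stage_rank r n (Suc m) S (Suc k - 1))))
      = (\<Sum>k = Suc p..m. \<mu> (Suc k) * rank_step S k)"
    using assms by (intro sum.cong) (auto simp: stage_rank.simps p_eq)
  ultimately show ?thesis
    unfolding flag_bound_merge_at unfolding flag_bound_def sum_split_at_Suc[OF pivot_range]
    using assms pivot_range by (simp add: stage_rank.simps flip: p_eq)
qed

text \<open>With row \<open>n - m\<close> the column \<open>p\<close> always adds 1, contributing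
  \<mu>(p), and the former increment at \<open>p\<close> is delayed to column \<open>p + 1\<close>,
  where its weight is \<mu>(p+1).\<close>

lemma flag_bound_in:
  assumes "n - m \<in> S"
  shows "flag_bound r n (Suc m) \<mu> S = \<mu> p + flag_bound r n m (merge_at p (\<mu> (Suc p)) \<mu>) S"
proof -
  have "(\<Sum>k = 1..<p. \<mu> k * (real (stage_rank r n (Suc m) S k) - real (stage_rank r n (Suc m) S (k - 1))))
      = (\<Sum>k = 1..<p. \<mu> k * rank_step S k)"
    using assms by (intro sum.cong) (auto simp: stage_rank.simps p_eq)
  moreover have "(\<Sum>k = Suc p..m. \<mu> (Suc k) *
        (real (stage_rank r n (Suc m) S (Suc k)) - real (stage_rank r n (Suc m) S (Suc k - 1))))
      = (\<Sum>k = Suc p..m. \<mu> (Suc k) * rank_step S k)"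
    using assms by (intro sum.cong) (auto simp: stage_rank.simps p_eq)
  ultimately show ?thesis
    unfolding flag_bound_merge_at unfolding flag_bound_def sum_split_at_Suc[OF pivot_range]
    using assms pivot_range by (simp add: stage_rank.simps flip: p_eq)
qed

lemma flag_bound_diff:
  "flag_bound r n m (merge_at p t \<mu>) S =
   flag_bound r n m (merge_at p s \<mu>) S + (t - s) * rank_step S p"
  unfolding flag_bound_merge_at by (simp add: algebra_simps)

lemma flag_bound_cong:
  assumes "S \<inter> {n - m<..n} = T \<inter> {n - m<..n}"
  shows "flag_bound r n m \<mu> S = flag_bound r n m \<mu> T"
proof -
  have "i \<in> S \<longleftrightarrow> i \<in> T" if "n - m < i" "i \<le> n" for i
    using assms that by (metis IntD1 IntI greaterThanAtMost_iff)
  then have "stage_rank r n m S k = stage_rank r n m T k" for k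
    using m by (intro stage_rank_cong) simp_all
  then show ?thesis by (simp add: flag_bound_def)
qed

lemma flag_bound_full: "flag_bound r n m \<mu> {n - m<..n} = (\<Sum>k = 1..m. \<mu> k)"
proof -
  have "stage_rank r n m {n - m<..n} k = k" if "k \<le> m" for k
    using stage_rank_full[of n r m k] r rn m that by simp
  then show ?thesis unfolding flag_bound_def by (intro sum.cong) (auto simp: of_nat_diff)
qed

text \<open>The constraints are paired as \<open>T\<close> and \<open>insert a T\<close>, with
  \<open>a\<close> the row eliminated. As the slope at \<open>p\<close> is 0 or 1, one bound of each
  pair becomes exactly the bound for \<open>T\<close> at \<open>t\<close>; the other follows from
  the range of \<open>z a\<close>.\<close>

lemma stage_polytope_Suc_iff:
  assumes nonneg: "0 \<le> \<mu> (Suc p)"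
  shows "z \<in> stage_polytope r n (Suc m) \<mu> \<longleftrightarrow>
     \<mu> (Suc p) \<le> z (n - m) \<and> z (n - m) \<le> \<mu> p \<and>
     z \<in> stage_polytope r n m (merge_at p (\<mu> p + \<mu> (Suc p) - z (n - m)) \<mu>)"
    (is "?L \<longleftrightarrow> ?R")
proof -
  define a where "a = n - m"
  define R where "R = {n - m<..n}"
  define t where "t = \<mu> p + \<mu> (Suc p) - z a"
  have rows: "{n - Suc m<..n} = insert a R" "a \<notin> R" "finite R"
    using m by (auto simp: a_def R_def)
  have bound_insert: "flag_bound r n (Suc m) \<mu> (insert a T) =
      \<mu> p + flag_bound r n m (merge_at p (\<mu> (Suc p)) \<mu>) T" for T
    using flag_bound_in[of "insert a T" \<mu>] flag_bound_cong[of "insert a T" T] rows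
    by (simp add: a_def R_def)
  have bound_sub: "flag_bound r n (Suc m) \<mu> T = flag_bound r n m (merge_at p (\<mu> p) \<mu>) T"
    if "T \<subseteq> R" for T
    using that rows(2) by (intro flag_bound_notin) (auto simp: a_def)
  have total: "(\<Sum>k = 1..m. merge_at p t \<mu> k) = (\<Sum>k = 1..Suc m. \<mu> k) - z a"
    using sum_merge_at[OF pivot_range, of t \<mu>] by (simp add: t_def)
  show ?thesis
  proof
    assume L: ?L
    then have sub: "sum z T \<le> flag_bound r n m (merge_at p (\<mu> p) \<mu>) T" if "T \<subseteq> R" for T
      using that rows bound_sub[OF that] by (auto simp: stage_polytope_def)
    have ins: "z a + sum z T \<le> \<mu> p + flag_bound r n m (merge_at p (\<mu> (Suc p)) \<mu>) T"
      if "T \<subseteq> R" for T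
    proof -
      have "insert a T \<subseteq> {n - Suc m<..n}" using that rows by auto
      then have "sum z (insert a T) \<le> flag_bound r n (Suc m) \<mu> (insert a T)"
        using L by (auto simp: stage_polytope_def)
      moreover have "sum z (insert a T) = z a + sum z T"
        using that rows by (intro sum.insert) (auto intro: finite_subset)
      ultimately show ?thesis unfolding bound_insert by simp
    qed
    have sum: "z a + sum z R = (\<Sum>k = 1..Suc m. \<mu> k)"
      using L rows by (simp add: stage_polytope_def)
    \<comment> \<open>The two extreme sets bound \<open>z a\<close>: the empty set from above, and
      all of \<open>R\<close>, by the fixed total, from below.\<close>
    have "flag_bound r n m \<nu> {} = 0" for \<nu> by (simp add: flag_bound_def stage_rank_empty)
    then have upper: "z a \<le> \<mu> p" using ins[of "{}"] by simp
    have lower: "\<mu> (Suc p) \<le> z a"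
      using sub[of R] sum sum_merge_at[OF pivot_range, of "\<mu> p" \<mu>] flag_bound_full by (simp add: R_def)
    \<comment> \<open>With slope 0 the bound at \<open>t\<close> equals that at \<mu>(p); with slope
      1 it is the bound for \<open>insert a T\<close> with \<open>z a\<close> moved across.\<close>
    have "sum z T \<le> flag_bound r n m (merge_at p t \<mu>) T" if "T \<subseteq> R" for T
      using rank_step_cases[of T]
    proof
      assume "rank_step T p = 0"
      then show ?thesis using sub[OF that] flag_bound_diff[of t \<mu> T "\<mu> p"] by simp
    next
      assume "rank_step T p = 1"
      then show ?thesis
        using ins[OF that] flag_bound_diff[of t \<mu> T "\<mu> (Suc p)"] by (simp add: t_def)
    qed
    moreover have "sum z R = (\<Sum>k = 1..m. merge_at p t \<mu> k)"
      using sum total by simp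
    moreover have "\<forall>i\<in>R. 0 \<le> z i" using L rows by (simp add: stage_polytope_def)
    ultimately have "z \<in> stage_polytope r n m (merge_at p t \<mu>)"
      by (simp add: stage_polytope_def R_def)
    then show ?R using upper lower by (simp add: t_def a_def)
  next
    assume ?R
    then have bounds: "\<mu> (Suc p) \<le> z a" "z a \<le> \<mu> p"
      and z: "z \<in> stage_polytope r n m (merge_at p t \<mu>)"
      by (simp_all add: t_def a_def)
    have sub: "sum z T \<le> flag_bound r n m (merge_at p t \<mu>) T" if "T \<subseteq> R" for T
      using z that by (simp add: stage_polytope_def R_def)
    have "sum z S \<le> flag_bound r n (Suc m) \<mu> S" if S: "S \<subseteq> insert a R" for S
    proof (cases "a \<in> S")
      case False
      then have T: "S \<subseteq> R" using S by auto
      \<comment> \<open>The lower bound on \<open>z a\<close> gives \<open>t \<le> \<mu> p\<close>,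
        and the bound grows with the merged part.\<close>
      have "(t - \<mu> p) * rank_step S p \<le> 0"
        using bounds rank_step_bounds[of S] by (intro mult_nonpos_nonneg) (auto simp: t_def)
      then show ?thesis
        using sub[OF T] flag_bound_diff[of t \<mu> S "\<mu> p"] bound_sub[OF T] by simp
    next
      case True
      define T where "T = S - {a}"
      have T: "T \<subseteq> R" and S_eq: "S = insert a T" "a \<notin> T" using S True by (auto simp: T_def)
      then have "sum z S = z a + sum z T"
        using rows by (auto intro!: sum.insert intro: finite_subset)
      \<comment> \<open>The upper bound on \<open>z a\<close> gives
        \<open>\<mu> (Suc p) \<le> t\<close>, and the slope is at most 1.\<close>
      moreover have "(t - \<mu> (Suc p)) * rank_step T p \<le> t - \<mu> (Suc p)"
        using bounds rank_step_bounds[of T] by (intro mult_left_le) (auto simp: t_def)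
      ultimately show ?thesis
        using sub[OF T] flag_bound_diff[of t \<mu> T "\<mu> (Suc p)"]
        unfolding S_eq(1) bound_insert by (simp add: t_def)
    qed
    moreover have "sum z (insert a R) = (\<Sum>k = 1..Suc m. \<mu> k)"
      using z total rows by (simp add: stage_polytope_def R_def)
    moreover have "\<forall>i\<in>insert a R. 0 \<le> z i"
      using z bounds nonneg by (auto simp: stage_polytope_def R_def)
    ultimately show ?L unfolding stage_polytope_def rows(1) by simp
  qed
qed

end

lemma stage_polytope_1_iff:
  assumes "r n = 1" "0 \<le> \<mu> 1" "1 \<le> n"
  shows "z \<in> stage_polytope r n 1 \<mu> \<longleftrightarrow> z n = \<mu> 1"
proof -
  have R: "{n - 1<..n} = {n}" using assms(3) by auto
  have bound: "flag_bound r n 1 \<mu> S = (if n \<in> S then \<mu> 1 else 0)" for S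
    using assms by (simp add: flag_bound_def stage_rank.simps)
  have "sum z S \<le> flag_bound r n 1 \<mu> S" if "S \<subseteq> {n}" "z n = \<mu> 1" for S
  proof -
    have "S = {} \<or> S = {n}" using that(1) by blast
    then show ?thesis using that(2) unfolding bound by auto
  qed
  then show ?thesis
    using assms(2) unfolding stage_polytope_def R by (simp, metis)
qed

section \<open>Unwinding the recursion\<close>

text \<open>The diagonal entries \<open>x\<^sub>i\<^sub>,\<^sub>i\<^sub>+\<^sub>j\<close> of the only pattern in the face that can map to \<open>z\<close>.\<close>

fun level :: "(nat \<Rightarrow> nat) \<Rightarrow> (nat \<Rightarrow> real) \<Rightarrow> (nat \<Rightarrow> real) \<Rightarrow> nat \<Rightarrow> nat \<Rightarrow> real" where
  "level r \<mu> z 0 = \<mu>"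
| "level r \<mu> z (Suc j) =
     merge_at (r (Suc j))
       (level r \<mu> z j (r (Suc j)) + level r \<mu> z j (Suc (r (Suc j))) - z (Suc j)) (level r \<mu> z j)"

text \<open>Collects the conditions \<open>v \<le> z\<^sub>1 \<le> u\<close> of the first
  \<open>j\<close> steps, each taken at its own level.\<close>

definition level_bounds ::
    "(nat \<Rightarrow> nat) \<Rightarrow> (nat \<Rightarrow> real) \<Rightarrow> (nat \<Rightarrow> real) \<Rightarrow> nat \<Rightarrow> bool" where
  "level_bounds r \<mu> z j \<longleftrightarrow>
     (\<forall>i<j. level r \<mu> z i (Suc (r (Suc i))) \<le> z (Suc i) \<and> z (Suc i) \<le> level r \<mu> z i (r (Suc i)))"

text \<open>The new part is \<open>u + v - z\<close>, which is at least \<open>v\<close> because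
  \<open>z \<le> u\<close>. Nonnegativity is what \<open>stage_polytope_Suc_iff\<close> asks for at
  each level.\<close>

lemma level_nonneg:
  assumes r: "\<And>i. 1 \<le> i \<Longrightarrow> i < n \<Longrightarrow> 1 \<le> r i \<and> r i \<le> n - i"
    and \<mu>: "\<And>k. 1 \<le> k \<Longrightarrow> k \<le> n \<Longrightarrow> 0 \<le> \<mu> k"
    and "level_bounds r \<mu> z j" "j < n" "1 \<le> k" "k \<le> n - j"
  shows "0 \<le> level r \<mu> z j k"
  using assms(3-)
proof (induction j arbitrary: k)
  case 0
  then show ?case using \<mu> by simp
next
  case (Suc j)
  have IH: "0 \<le> level r \<mu> z j k" if "1 \<le> k" "k \<le> n - j" for k
    using Suc that by (intro Suc.IH) (auto simp: level_bounds_def)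
  have "1 \<le> r (Suc j)" "r (Suc j) \<le> n - Suc j" using r[of "Suc j"] Suc.prems by auto
  moreover from this have below: "0 \<le> level r \<mu> z j (Suc (r (Suc j)))"
    using Suc.prems by (intro IH) auto
  moreover have "z (Suc j) \<le> level r \<mu> z j (r (Suc j))"
    using Suc.prems by (simp add: level_bounds_def)
  ultimately show ?case
    using IH[of k] IH[of "Suc k"] below Suc.prems
    by (auto simp: merge_at_def)
qed

text \<open>The new part lies between the two parts it replaces, so the order survives; this later
  yields the interlacing inequalities of a pattern.\<close>

lemma level_antimono:
  assumes r: "\<And>i. 1 \<le> i \<Longrightarrow> i < n \<Longrightarrow> 1 \<le> r i \<and> r i \<le> n - i"
    and \<mu>: "\<And>k. 1 \<le> k \<Longrightarrow> k < n \<Longrightarrow> \<mu> (Suc k) \<le> \<mu> k"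
    and "level_bounds r \<mu> z j" "j < n" "1 \<le> k" "k < n - j"
  shows "level r \<mu> z j (Suc k) \<le> level r \<mu> z j k"
  using assms(3-)
proof (induction j arbitrary: k)
  case 0
  then show ?case using \<mu> by simp
next
  case (Suc j)
  have IH: "level r \<mu> z j (Suc k) \<le> level r \<mu> z j k" if "1 \<le> k" "k < n - j" for k
    using Suc that by (intro Suc.IH) (auto simp: level_bounds_def)
  have zb: "z (Suc j) \<le> level r \<mu> z j (r (Suc j))"
      "level r \<mu> z j (Suc (r (Suc j))) \<le> z (Suc j)"
    using Suc.prems by (simp_all add: level_bounds_def)
  have k: "1 \<le> k" "k < n - j" "1 \<le> Suc k" "Suc k < n - j" using Suc.prems by auto
  note mono = IH[OF k(1,2)] IH[OF k(3,4)]
  consider "Suc k < r (Suc j)" | "Suc k = r (Suc j)" | "k = r (Suc j)" | "r (Suc j) < k"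
    by linarith
  then show ?case
  proof cases
    case 1
    then show ?thesis using mono by (simp add: merge_at_def)
  next
    case 2
    then show ?thesis using mono zb by (simp add: merge_at_def flip: 2)
  next
    case 3
    then show ?thesis using mono zb by (simp add: merge_at_def flip: 3)
  next
    case 4
    then show ?thesis using mono by (simp add: merge_at_def)
  qed
qed

lemma stage_polytope_iff_level_bounds:
  assumes r: "\<And>i. 1 \<le> i \<Longrightarrow> i < n \<Longrightarrow> 1 \<le> r i \<and> r i \<le> n - i" and rn: "r n = 1"
    and \<mu>: "\<And>k. 1 \<le> k \<Longrightarrow> k \<le> n \<Longrightarrow> 0 \<le> \<mu> k" and n: "1 \<le> n"
  shows "z \<in> stage_polytope r n n \<mu> \<longleftrightarrow>
    level_bounds r \<mu> z (n - 1) \<and> z n = level r \<mu> z (n - 1) 1"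
proof -
  have step: "z \<in> stage_polytope r n n \<mu> \<longleftrightarrow>
      level_bounds r \<mu> z j \<and> z \<in> stage_polytope r n (n - j) (level r \<mu> z j)" if "j < n" for j
    using that
  proof (induction j)
    case 0
    then show ?case by (simp add: level_bounds_def)
  next
    case (Suc j)
    define m where "m = n - Suc j"
    have m: "1 \<le> m" "m < n" "n - m = Suc j" "n - j = Suc m" using Suc.prems by (auto simp: m_def)
    \<comment> \<open>Restricted to sequences satisfying the earlier bounds, since only these keep
      level \<open>j\<close> nonnegative.\<close>
    have *: "z \<in> stage_polytope r n (n - j) (level r \<mu> z j) \<longleftrightarrow>
        level r \<mu> z j (Suc (r (Suc j))) \<le> z (Suc j) \<and> z (Suc j) \<le> level r \<mu> z j (r (Suc j)) \<and>
        z \<in> stage_polytope r n (n - Suc j) (level r \<mu> z (Suc j))"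
      if "level_bounds r \<mu> z j"
    proof -
      have "0 \<le> level r \<mu> z j (Suc (r (Suc j)))"
        using r[of "Suc j"] Suc.prems by (intro level_nonneg[OF r \<mu> that]) auto
      then show ?thesis
        using stage_polytope_Suc_iff[OF r rn m(1,2) refl, of "level r \<mu> z j" z] m
        by (simp add: m_def[symmetric])
    qed
    have "level_bounds r \<mu> z (Suc j) \<longleftrightarrow> level_bounds r \<mu> z j \<and>
        level r \<mu> z j (Suc (r (Suc j))) \<le> z (Suc j) \<and> z (Suc j) \<le> level r \<mu> z j (r (Suc j))"
      by (auto simp: level_bounds_def less_Suc_eq)
    then show ?case using Suc * by auto
  qed
  have "z \<in> stage_polytope r n 1 (level r \<mu> z (n - 1)) \<longleftrightarrow> z n = level r \<mu> z (n - 1) 1"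
    if "level_bounds r \<mu> z (n - 1)"
    using rn n level_nonneg[OF r \<mu> that] by (intro stage_polytope_1_iff) auto
  then show ?thesis using step[of "n - 1"] n by auto
qed

text \<open>Summation by parts, turning the bound in \<open>FM\<close> into
  \<open>flag_bound\<close>. The induction keeps the boundary term \<open>f (m + 1) * g m\<close>,
  which then cancels the last summand's missing subtraction.\<close>

lemma sum_diff_mult_eq_sum_mult_diff:
  fixes f g :: "nat \<Rightarrow> real"
  assumes "g 0 = 0"
  shows "(\<Sum>k = 1..m. (f k - (if k = m then 0 else f (k + 1))) * g k) =
         (\<Sum>k = 1..m. f k * (g k - g (k - 1)))"
proof -
  have "(\<Sum>k = 1..m. (f k - f (k + 1)) * g k) + f (m + 1) * g m =
      (\<Sum>k = 1..m. f k * (g k - g (k - 1)))" for m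
    using assms by (induction m) (auto simp: algebra_simps)
  moreover have "(\<Sum>k = 1..m. (f k - (if k = m then 0 else f (k + 1))) * g k) =
      (\<Sum>k = 1..m. (f k - f (k + 1)) * g k) + f (m + 1) * g m"
    using assms by (cases m) (auto simp: algebra_simps)
  ultimately show ?thesis by simp
qed

subsection \<open>The ranks of the matrix of a permutation\<close>

text \<open>Eliminating a row deletes the column of its \<open>\<star>\<^sub>2\<close>; these
  columns survive the rows above \<open>j\<close>.\<close>

definition remaining_cols :: "nat \<Rightarrow> (nat \<Rightarrow> nat) \<Rightarrow> nat \<Rightarrow> nat set" where
  "remaining_cols n w j = star2_col n w ` {j..n}"

text \<open>The position of \<open>\<star>\<^sub>1\<close> among the surviving columns, by
  \<open>left_cols\<close>. Row \<open>n\<close> has no \<open>\<star>\<^sub>1\<close>; the value 1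
  there points to its only surviving column.\<close>

definition pivot_pos :: "nat \<Rightarrow> (nat \<Rightarrow> nat) \<Rightarrow> nat \<Rightarrow> nat" where
  "pivot_pos n w j = (if j = n then 1 else gz_r n w j)"

text \<open>After columns have been deleted, the first \<open>k\<close> columns become a set of this
  kind.\<close>

definition initial_segment :: "'a::order set \<Rightarrow> 'a set \<Rightarrow> bool" where
  "initial_segment R K \<longleftrightarrow> K \<subseteq> R \<and> (\<forall>x\<in>K. \<forall>y\<in>R. y < x \<longrightarrow> y \<in> K)"

context
  fixes n :: nat and w :: "nat \<Rightarrow> nat"
  assumes n: "n \<ge> 2" and w: "w permutes {1..n - 1}"
begin

lemma inv_permutes_rows: "inv_into UNIV w permutes {1..n - 1}"
  using w by (rule permutes_inv)

lemma star2_col_n: "star2_col n w n = 1"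
  by (simp add: star2_col_def)

lemma star2_col_less:
  assumes "1 \<le> i" "i < n"
  shows "star2_col n w i = Suc (inv_into UNIV w i)" "1 \<le> inv_into UNIV w i" "inv_into UNIV w i < n"
proof -
  have "inv_into UNIV w i \<in> {1..n - 1}"
    using permutes_in_image[OF inv_permutes_rows, of i] assms by simp
  then show "star2_col n w i = Suc (inv_into UNIV w i)"
    "1 \<le> inv_into UNIV w i" "inv_into UNIV w i < n"
    using assms by (simp_all add: star2_col_def) linarith
qed

lemma inj_on_star2_col: "inj_on (star2_col n w) {1..n}"
proof (rule inj_onI)
  fix i k assume ik: "i \<in> {1..n}" "k \<in> {1..n}" "star2_col n w i = star2_col n w k"
  consider "i = n" "k = n" | "i = n" "k < n" | "i < n" "k = n" | "i < n" "k < n"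
    using ik(1,2) by fastforce
  then show "i = k"
  proof cases
    case 2
    then show ?thesis using ik star2_col_n star2_col_less[of k] by simp
  next
    case 3
    then show ?thesis using ik star2_col_n star2_col_less[of i] by simp
  next
    case 4
    then have "inv_into UNIV w i = inv_into UNIV w k"
      using ik star2_col_less(1)[of i] star2_col_less(1)[of k] by simp
    then show ?thesis by (rule injD[OF permutes_inj[OF inv_permutes_rows]])
  qed simp
qed

lemma star2_col_image: "star2_col n w ` {1..n} = {1..n}"
proof (rule card_subset_eq)
  show "star2_col n w ` {1..n} \<subseteq> {1..n}"
  proof
    fix c assume "c \<in> star2_col n w ` {1..n}"
    then obtain i where i: "i \<in> {1..n}" "c = star2_col n w i" by auto
    then show "c \<in> {1..n}"
      using star2_col_n star2_col_less[of i] n by (cases "i = n") simp_all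
  qed
  show "card (star2_col n w ` {1..n}) = card {1..n}"
    using inj_on_star2_col by (rule card_image)
qed simp

lemma remaining_cols_1: "remaining_cols n w 1 = {1..n}"
  using star2_col_image by (simp add: remaining_cols_def)

lemma remaining_cols_split:
  assumes "1 \<le> j" "j \<le> n"
  shows "remaining_cols n w j = insert (star2_col n w j) (remaining_cols n w (Suc j))"
    and "star2_col n w j \<notin> remaining_cols n w (Suc j)"
proof -
  have "{j..n} = insert j {Suc j..n}" using assms by auto
  then show "remaining_cols n w j = insert (star2_col n w j) (remaining_cols n w (Suc j))"
    by (simp only: remaining_cols_def image_insert)
  show "star2_col n w j \<notin> remaining_cols n w (Suc j)"
  proof
    assume "star2_col n w j \<in> remaining_cols n w (Suc j)"
    then obtain k where k: "k \<in> {Suc j..n}" "star2_col n w j = star2_col n w k"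
      by (auto simp: remaining_cols_def)
    then have "j = k" using assms by (intro inj_onD[OF inj_on_star2_col k(2)]) simp_all
    then show False using k by simp
  qed
qed

lemma remaining_cols_antimono: "i \<le> j \<Longrightarrow> remaining_cols n w j \<subseteq> remaining_cols n w i"
  unfolding remaining_cols_def by (intro image_mono) simp

lemma finite_remaining_cols: "finite (remaining_cols n w j)"
  by (simp add: remaining_cols_def)

text \<open>Links the two sides of the theorem. With \<open>Q\<close> the competitors smaller than
  \<open>w\<^sup>-\<^sup>1(j)\<close>, the set counted by \<open>gz_r\<close> is \<open>Q\<close>
  with \<open>w\<^sup>-\<^sup>1(j)\<close> added, while \<open>P\<close> is \<open>Q\<close> shifted
  by one with column 1 added, whose \<open>\<star>\<^sub>2\<close> waits in row
  \<open>n\<close>.\<close>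

lemma left_cols:
  assumes "1 \<le> j" "j < n"
  defines "P \<equiv> {x \<in> remaining_cols n w j. x < star2_col n w j}"
  shows "1 \<in> P" and "card P = gz_r n w j" and "star1_col n w j = Max P"
proof -
  let ?v = "inv_into UNIV w"
  have v_pos: "1 \<le> ?v i" if "1 \<le> i" "i < n" for i
    using permutes_in_image[OF inv_permutes_rows, of i] that by auto
  have "1 \<in> remaining_cols n w j"
    unfolding remaining_cols_def using assms(1,2) star2_col_n
    by (intro image_eqI[of _ _ n]) simp_all
  moreover have "1 < star2_col n w j"
    using v_pos[of j] assms by (simp add: star2_col_def)
  ultimately show "1 \<in> P" by (simp add: P_def)
  define Q where "Q = {v \<in> ?v ` {j..n - 1}. v < ?v j}"
  have "{j..n} = insert n {j..n - 1}" using assms(1,2) by auto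
  then have "remaining_cols n w j = insert 1 (star2_col n w ` {j..n - 1})"
    by (simp only: remaining_cols_def image_insert star2_col_n)
  also have "star2_col n w ` {j..n - 1} = Suc ` ?v ` {j..n - 1}"
    unfolding image_image using assms(1,2) by (intro image_cong) (auto simp: star2_col_def)
  finally have "P = {x \<in> insert 1 (Suc ` ?v ` {j..n - 1}). x < Suc (?v j)}"
    using assms(2) by (simp add: P_def star2_col_def)
  also have "\<dots> = insert 1 (Suc ` Q)"
    unfolding Q_def using v_pos[of j] assms(1,2) by auto
  finally have "P = insert 1 (Suc ` Q)" .
  moreover have "1 \<notin> Suc ` Q"
  proof
    assume "1 \<in> Suc ` Q"
    then have "0 \<in> ?v ` {j..n - 1}" unfolding Q_def by auto
    then obtain i where "i \<in> {j..n - 1}" "?v i = 0" by auto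
    moreover from this have "1 \<le> i" "i < n" using assms(1,2) by auto
    ultimately show False using v_pos[of i] by simp
  qed
  moreover have "finite Q" by (simp add: Q_def)
  ultimately have "card P = Suc (card Q)" by (simp add: card_image)
  moreover have "{v \<in> ?v ` {j..n - 1}. v \<le> ?v j} = insert (?v j) Q"
    using assms(1,2) unfolding Q_def by auto
  then have "gz_r n w j = Suc (card Q)"
    using \<open>finite Q\<close> by (simp add: gz_r_def) (simp add: Q_def)
  ultimately show "card P = gz_r n w j" by simp
  \<comment> \<open>Each column holds exactly one \<open>\<star>\<^sub>2\<close>, so the columns
    avoided by the rows above \<open>j\<close> are those used from row \<open>j\<close> on.\<close>
  have "{c. 1 \<le> c \<and> c < star2_col n w j \<and> (\<forall>k. 1 \<le> k \<and> k < j \<longrightarrow> star2_col n w k \<noteq> c)} = P"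
    (is "?C = P")
  proof
    show "?C \<subseteq> P"
    proof
      fix c assume c: "c \<in> ?C"
      have "star2_col n w j \<in> {1..n}" using star2_col_image assms by (metis atLeastAtMost_iff image_eqI less_imp_le)
      then have "c \<in> star2_col n w ` {1..n}" unfolding star2_col_image using c by simp
      then obtain k where k: "k \<in> {1..n}" "c = star2_col n w k" by auto
      then have "j \<le> k" using c by (metis (mono_tags, lifting) atLeastAtMost_iff mem_Collect_eq not_le)
      then show "c \<in> P" using k c by (auto simp: P_def remaining_cols_def)
    qed
    show "P \<subseteq> ?C"
    proof
      fix c assume c: "c \<in> P"
      then obtain i where i: "i \<in> {j..n}" "c = star2_col n w i"
        by (auto simp: P_def remaining_cols_def)
      have "star2_col n w k \<noteq> c" if "1 \<le> k" "k < j" for k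
        using inj_onD[OF inj_on_star2_col, of k i] that i assms by auto
      moreover have "1 \<le> c" using star2_col_image i assms
        by (metis atLeastAtMost_iff image_eqI le_trans)
      ultimately show "c \<in> ?C" using c by (auto simp: P_def)
    qed
  qed
  then show "star1_col n w j = Max P" by (simp add: star1_col_def)
qed

lemma finite_left_cols: "finite {x \<in> remaining_cols n w j. x < star2_col n w j}"
  by (simp add: finite_remaining_cols)

lemma star1_col_in:
  assumes "1 \<le> j" "j < n"
  shows "star1_col n w j \<in> remaining_cols n w j" "star1_col n w j < star2_col n w j"
proof -
  let ?P = "{x \<in> remaining_cols n w j. x < star2_col n w j}"
  have "?P \<noteq> {}" using left_cols(1)[OF assms] by (metis empty_iff)
  then have "star1_col n w j \<in> ?P"
    unfolding left_cols(3)[OF assms] by (rule Max_in[OF finite_left_cols])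
  then show "star1_col n w j \<in> remaining_cols n w j" "star1_col n w j < star2_col n w j"
    by simp_all
qed

lemma pivot_pos_bounds:
  assumes "1 \<le> i" "i < n"
  shows "1 \<le> pivot_pos n w i \<and> pivot_pos n w i \<le> n - i"
proof -
  let ?P = "{x \<in> remaining_cols n w i. x < star2_col n w i}"
  have "card (remaining_cols n w (Suc i)) \<le> card {Suc i..n}"
    unfolding remaining_cols_def by (intro card_image_le) simp
  moreover have "?P \<subseteq> remaining_cols n w (Suc i)"
    using remaining_cols_split(1)[of i] assms by auto
  then have "card ?P \<le> card (remaining_cols n w (Suc i))"
    by (intro card_mono finite_remaining_cols)
  moreover have "0 < card ?P"
    using left_cols(1)[OF assms] finite_left_cols[of i] card_gt_0_iff by blast
  ultimately show ?thesis using left_cols(2)[OF assms] assms by (simp add: pivot_pos_def)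
qed

lemma pivot_pos_n: "pivot_pos n w n = 1"
  by (simp add: pivot_pos_def)

text \<open>Induction eliminating the top row \<open>j\<close>. If \<open>c \<in> K\<close>, then
  \<open>c\<close> is a pivot column or, for \<open>j \<notin> S\<close>, a zero column. Otherwise
  \<open>K \<subseteq> P\<close>, and row \<open>j\<close> meets \<open>K\<close> at most in
  \<open>p\<close>, giving a pivot row or a zero row.\<close>

lemma has_rank_initial_segment:
  fixes e :: "nat \<Rightarrow> nat \<Rightarrow> 'a::field"
  assumes e: "\<And>i j. i \<in> {1..n} \<Longrightarrow> j \<in> {1..n} \<Longrightarrow>
      e i j \<noteq> 0 \<longleftrightarrow> j = star2_col n w i \<or> i < n \<and> j = star1_col n w i"
    and "m \<le> n" "S \<subseteq> {n - m<..n}" "initial_segment (remaining_cols n w (Suc (n - m))) K"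
  shows "has_rank e S K (stage_rank (pivot_pos n w) n m S (card K))"
  using assms(2-4)
proof (induction m arbitrary: S K)
  case 0
  then have "K = {}" by (auto simp: initial_segment_def remaining_cols_def)
  then show ?case by (simp add: has_rank_empty)
next
  case (Suc m)
  define j where "j = n - m"
  define c where "c = star2_col n w j"
  define R where "R = remaining_cols n w j"
  define P where "P = {x \<in> R. x < c}"
  define p where "p = star1_col n w j"
  let ?r = "pivot_pos n w"
  have j: "1 \<le> j" "j \<le> n" "Suc (n - Suc m) = j" "Suc (n - m) = Suc j"
    using Suc.prems(1) by (auto simp: j_def)
  have R: "R = insert c (remaining_cols n w (Suc j))" "c \<notin> remaining_cols n w (Suc j)"
    using remaining_cols_split[OF j(1,2)] by (simp_all add: R_def c_def)
  have finR: "finite R" by (simp add: R_def finite_remaining_cols)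
  have R_sub: "R \<subseteq> {1..n}"
    using remaining_cols_antimono[OF j(1)] remaining_cols_1 by (simp add: R_def)
  have KR: "K \<subseteq> R" and K: "\<And>x y. x \<in> K \<Longrightarrow> y \<in> R \<Longrightarrow> y < x \<Longrightarrow> y \<in> K"
    using Suc.prems(3) by (auto simp: initial_segment_def j R_def)
  have finK: "finite K" using KR finR by (rule finite_subset)
  have "{n - Suc m<..n} \<subseteq> insert j {n - m<..n}" by (auto simp: j_def)
  then have S: "S \<subseteq> insert j {n - m<..n}" using Suc.prems(2) by (rule order_trans[rotated])
  have later: "j < i \<and> i \<le> n" if "i \<in> S - {j}" for i using S that by (auto simp: j_def)
  \<comment> \<open>Both symbols of a later row sit in columns that survive row \<open>j\<close>,
    and \<open>c\<close> does not.\<close>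
  have col0: "e i c = 0" if "i \<in> S - {j}" for i
  proof -
    have i: "1 \<le> i" "i \<le> n" "Suc j \<le> i" using later[OF that] j by auto
    have sub: "remaining_cols n w i \<subseteq> remaining_cols n w (Suc j)"
      using i(3) by (rule remaining_cols_antimono)
    have "star2_col n w i \<in> remaining_cols n w i" using i by (auto simp: remaining_cols_def)
    then have "c \<noteq> star2_col n w i" using sub R(2) by auto
    moreover have "c \<noteq> star1_col n w i" if "i < n"
      using star1_col_in(1)[OF i(1) that] sub R(2) by auto
    moreover have "c \<in> {1..n}" using R_sub R(1) by auto
    ultimately show ?thesis using e[of i c] i by auto
  qed
  have IH: "has_rank e T L (stage_rank ?r n m S (card L))"
    if "T \<subseteq> {n - m<..n}" "T = S - {j}" "initial_segment (remaining_cols n w (Suc j)) L" for T L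
  proof -
    have "has_rank e T L (stage_rank ?r n m T (card L))"
      using that Suc.prems(1) by (intro Suc.IH) (simp_all add: j)
    moreover have "stage_rank ?r n m T k = stage_rank ?r n m S k" for k
      using that Suc.prems(1) by (intro stage_rank_cong) (auto simp: j_def)
    ultimately show ?thesis by simp
  qed
  have Sj: "S - {j} \<subseteq> {n - m<..n}" using S by auto
  have rank_Suc: "stage_rank ?r n (Suc m) S k =
      (if j \<in> S then if k < ?r j then stage_rank ?r n m S k else Suc (stage_rank ?r n m S (k - 1))
       else stage_rank ?r n m S (if k \<le> ?r j then k else k - 1))" for k
    by (simp add: stage_rank.simps j_def)
  have r_card: "?r j = card P" "p \<in> P" "p = Max P" if "j < n"
  proof -
    show "?r j = card P" using left_cols(2)[OF j(1) that] that by (simp add: pivot_pos_def P_def R_def c_def)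
    show "p \<in> P" using star1_col_in[OF j(1) that] by (simp add: p_def P_def R_def c_def)
    show "p = Max P" using left_cols(3)[OF j(1) that] by (simp add: p_def P_def R_def c_def)
  qed
  have last: "R = {1}" "c = 1" "P = {}" "m = 0" if "j = n"
    using that Suc.prems(1) by (auto simp: R_def c_def P_def remaining_cols_def star2_col_def j_def)
  have e_c: "e j c \<noteq> 0" using e[of j c] R_sub R(1) j by (auto simp: c_def)
  show ?case
  proof (cases "c \<in> K")
    case True
    have PK: "P \<subseteq> K" using K True by (auto simp: P_def)
    have seg: "initial_segment (remaining_cols n w (Suc j)) (K - {c})"
      using KR K R by (auto simp: initial_segment_def)
    have cardK: "card (K - {c}) = card K - 1" "1 \<le> card K"
      using True finK card_gt_0_iff[of K] by (auto simp: Suc_le_eq)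
    have "insert c P \<subseteq> K" "c \<notin> P" "finite P" using PK True finR by (auto simp: P_def)
    then have big: "Suc (card P) \<le> card K" using card_mono[OF finK, of "insert c P"] by simp
    show ?thesis
    proof (cases "j \<in> S")
      case jS: True
      have "has_rank e (insert j (S - {j})) K (Suc (stage_rank ?r n m S (card (K - {c}))))"
        using True e_c col0 by (intro has_rank_pivot_col[of c] IH[OF Sj refl seg]) auto
      moreover have "\<not> card K < ?r j"
        using big r_card(1) j(2) pivot_pos_n by (cases "j = n") simp_all
      ultimately show ?thesis using jS cardK by (simp add: rank_Suc insert_absorb)
    next
      case jS: False
      have "has_rank e (S - {j}) K (stage_rank ?r n m S (card (K - {c})))"
        using col0 by (intro has_rank_zero_col[OF _ IH[OF Sj refl seg]]) simp
      \<comment> \<open>Only the last row violates \<open>?r j < card K\<close>; there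
        \<open>m = 0\<close>, so both branches of the recursion give 0.\<close>
      moreover have "stage_rank ?r n m S k = 0" if "card K \<le> ?r j" for k
      proof -
        have "j = n" using that big r_card(1) j(2) by (cases "j = n") simp_all
        then show ?thesis using last(4) by simp
      qed
      ultimately show ?thesis
        using jS cardK by (cases "card K \<le> ?r j") (simp_all add: rank_Suc)
    qed
  next
    case False
    have KP: "K \<subseteq> P"
    proof
      fix x assume x: "x \<in> K"
      have "c \<in> R" using R by simp
      then have "x \<le> c" using K[OF x, of c] False by (metis not_le)
      moreover have "x \<noteq> c" using x False by metis
      ultimately show "x \<in> P" using x KR unfolding P_def by auto
    qed
    have seg: "initial_segment (remaining_cols n w (Suc j)) K"
      using KR K R False by (auto simp: initial_segment_def)
    have finP: "finite P" using finR by (simp add: P_def)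
    have small: "card K \<le> ?r j"
      using card_mono[OF finP KP] r_card(1) last(3) j(2) KP by (cases "j = n") simp_all
    have row: "e j x \<noteq> 0 \<longleftrightarrow> j < n \<and> x = p" if "x \<in> K" for x
    proof -
      have "x \<in> {1..n}" "x \<noteq> c" using that KR R_sub False by auto
      then show ?thesis using e[of j x] j(1,2) by (simp add: c_def p_def)
    qed
    show ?thesis
    proof (cases "j \<in> S")
      case jS: False
      then show ?thesis using IH[OF Sj refl seg] small by (simp add: rank_Suc)
    next
      case jS: True
      show ?thesis
      proof (cases "j < n \<and> p \<in> K")
        case pK: True
        \<comment> \<open>As \<open>p\<close> is the largest column of \<open>P\<close>, an initial
          segment containing it exhausts \<open>P\<close>, and removing it leaves an initial
          segment.\<close>
        have "K = P"
        proof
          show "P \<subseteq> K"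
          proof
            fix x assume x: "x \<in> P"
            then have "x \<le> p" unfolding r_card(3)[OF conjunct1[OF pK]] using finP by simp
            then show "x \<in> K" using pK K[of p x] x by (cases "x = p") (auto simp: P_def)
          qed
        qed (rule KP)
        then have "card K = ?r j" using r_card(1) pK by simp
        moreover have "card (K - {p}) = card K - 1" using pK finK by simp
        moreover have "has_rank e (insert j (S - {j})) K (Suc (stage_rank ?r n m S (card (K - {p}))))"
        proof (rule has_rank_pivot_row[OF _ _ _ IH[OF Sj refl]])
          show "p \<in> K" "e j p \<noteq> 0" using pK row by blast+
          show "\<forall>x\<in>K - {p}. e j x = 0" using row by blast
          show "initial_segment (remaining_cols n w (Suc j)) (K - {p})"
            unfolding initial_segment_def
          proof (intro conjI ballI impI)
            show "K - {p} \<subseteq> remaining_cols n w (Suc j)" using KR R False by blast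
            fix x y assume xy: "x \<in> K - {p}" "y \<in> remaining_cols n w (Suc j)" "y < x"
            have "x \<in> P" using xy(1) KP by blast
            then have "x \<le> p" unfolding r_card(3)[OF conjunct1[OF pK]] using finP by simp
            moreover have "y \<in> K" using xy R(1) by (intro K[of x y]) auto
            ultimately show "y \<in> K - {p}" using xy(3) by auto
          qed
        qed
        ultimately show ?thesis using jS by (simp add: rank_Suc insert_absorb)
      next
        case pK: False
        have "has_rank e (insert j (S - {j})) K (stage_rank ?r n m S (card K))"
        proof (rule has_rank_zero_row[OF _ IH[OF Sj refl seg]])
          show "\<forall>x\<in>K. e j x = 0" using row pK by blast
        qed
        \<comment> \<open>Either row \<open>n\<close> is reached and \<open>K\<close> is empty, or
          \<open>K\<close> misses \<open>p\<close> and is a proper subset of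
          \<open>P\<close>.\<close>
        moreover have "card K < ?r j"
        proof (cases "j = n")
          case True
          then show ?thesis using KP last(3) pivot_pos_n by simp
        next
          case False
          then have "j < n" using j(2) by simp
          then have "K \<subset> P" using KP pK r_card(2) by (metis psubsetI)
          then show ?thesis using psubset_card_mono[OF finP] r_card(1)[OF \<open>j < n\<close>] by simp
        qed
        ultimately show ?thesis using jS by (simp add: rank_Suc insert_absorb)
      qed
    qed
  qed
qed

lemma sub_rank_A_mat:
  assumes nz: "\<forall>v\<in>star_positions n w. a v \<noteq> 0" and "S \<subseteq> {1..n}" "k \<le> n"
  shows "sub_rank (A_mat n w a) S k = stage_rank (pivot_pos n w) n n S k"
proof (rule sub_rank_eqI[OF _ assms(2,3)])
  define e where "e = (\<lambda>i j. A_mat n w a $$ (i - 1, j - 1))"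
  have e_nz: "e i j \<noteq> 0 \<longleftrightarrow> j = star2_col n w i \<or> i < n \<and> j = star1_col n w i"
    if "i \<in> {1..n}" "j \<in> {1..n}" for i j
  proof -
    have "e i j = (if (i, j) \<in> star_positions n w then a (i, j) else 0)"
      using that by (cases i; cases j) (simp_all add: e_def A_mat_def)
    moreover have "(i, j) \<in> star_positions n w \<longleftrightarrow> j = star2_col n w i \<or> i < n \<and> j = star1_col n w i"
      using that by (auto simp: star_positions_def)
    ultimately show ?thesis using nz by auto
  qed
  have "initial_segment {1..n} {1..k}"
    using assms(3) by (auto simp: initial_segment_def)
  then have seg: "initial_segment (remaining_cols n w (Suc (n - n))) {1..k}"
    using remaining_cols_1 by simp
  have S: "S \<subseteq> {n - n<..n}" using assms(2) by auto
  have "has_rank e S {1..k} (stage_rank (pivot_pos n w) n n S (card {1..k}))"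
    by (rule has_rank_initial_segment[of e n S "{1..k}", OF e_nz order_refl S seg])
  then show "has_rank (\<lambda>i j. A_mat n w a $$ (i - 1, j - 1)) S {1..k}
      (stage_rank (pivot_pos n w) n n S k)"
    by (simp add: e_def)
qed (simp add: A_mat_def)

lemma FM_A_mat_iff:
  assumes nz: "\<forall>v\<in>star_positions n w. a v \<noteq> 0"
  shows "z \<in> FM n lam (A_mat n w a) \<longleftrightarrow>
    z \<in> carrier_vec n \<and> (\<lambda>i. z $ (i - 1)) \<in> stage_polytope (pivot_pos n w) n n lam"
proof -
  have pos: "1 \<le> pivot_pos n w i" if "1 \<le> i" "i \<le> n" for i
  proof (cases "i = n")
    case True
    then show ?thesis by (simp add: pivot_pos_def)
  next
    case False
    then show ?thesis using pivot_pos_bounds[of i] that by simp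
  qed
  have rows: "{n - n<..n} = {1..n}" by auto
  have "(\<Sum>j = 1..n. (lam j - (if j = n then 0 else lam (j + 1))) * real (sub_rank (A_mat n w a) S j))
      = flag_bound (pivot_pos n w) n n lam S" if "S \<subseteq> {1..n}" for S
  proof -
    let ?g = "\<lambda>k. real (stage_rank (pivot_pos n w) n n S k)"
    have "(\<Sum>j = 1..n. (lam j - (if j = n then 0 else lam (j + 1))) * real (sub_rank (A_mat n w a) S j))
      = (\<Sum>j = 1..n. (lam j - (if j = n then 0 else lam (j + 1))) * ?g j)"
      using sub_rank_A_mat[OF nz that] by (intro sum.cong) auto
    also have "\<dots> = flag_bound (pivot_pos n w) n n lam S"
      unfolding flag_bound_def using stage_rank_zero[of n "pivot_pos n w" n S, OF pos]
      by (intro sum_diff_mult_eq_sum_mult_diff) simp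
    finally show ?thesis .
  qed
  then show ?thesis unfolding FM_def stage_polytope_def rows by simp
qed

end

subsection \<open>Gelfand--Zetlin faces\<close>

text \<open>The face equations copy every entry of diagonal \<open>j + 1\<close> except the one at
  \<open>p\<close> from diagonal \<open>j\<close>, which is the pattern of \<open>merge_at\<close>;
  the difference of the diagonal sums then determines the free entry.\<close>

lemma gz_entry_eq_level:
  assumes r: "\<And>i. 1 \<le> i \<Longrightarrow> i < n \<Longrightarrow> 1 \<le> r i \<and> r i \<le> n - i"
    and gz_r: "\<And>j. 1 \<le> j \<Longrightarrow> j < n \<Longrightarrow> gz_r n w j = r j"
    and x: "x \<in> GZ_face n lam w"
    and z: "\<And>j. Suc j < n \<Longrightarrow> z (Suc j) = gz_y n lam x j - gz_y n lam x (Suc j)"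
    and "j < n" "1 \<le> i" "i \<le> n - j"
  shows "gz_entry lam x i (i + j) = level r lam z j i"
  using assms(5-7)
proof (induction j arbitrary: i)
  case 0
  then show ?case by (simp add: gz_entry_def)
next
  case (Suc j)
  define p where "p = r (Suc j)"
  define m where "m = n - Suc j"
  define t where "t = gz_entry lam x p (p + Suc j)"
  have p: "1 \<le> p" "p \<le> m" using r[of "Suc j"] Suc.prems(1) by (simp_all add: p_def m_def)
  have m: "n - j = Suc m" using Suc.prems(1) by (simp add: m_def)
  have IH: "gz_entry lam x i (i + j) = level r lam z j i" if "1 \<le> i" "i \<le> Suc m" for i
    using that Suc.prems(1) m by (intro Suc.IH) simp_all
  have J: "Suc j \<in> {1..n - 1}" and p_gz: "gz_r n w (Suc j) = p"
    using Suc.prems(1) gz_r[of "Suc j"] by (simp_all add: p_def)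
  have below: "\<forall>i. 1 \<le> i \<and> i + 1 \<le> p \<longrightarrow>
        gz_entry lam x i (i + Suc j) = gz_entry lam x i (i + Suc j - 1)"
    and above: "\<forall>i. p + 1 \<le> i \<and> i \<le> n - Suc j \<longrightarrow>
        gz_entry lam x i (i + Suc j) = gz_entry lam x (i + 1) (i + Suc j)"
    using x J unfolding GZ_face_def p_gz[symmetric] by blast+
  have entry: "gz_entry lam x i (i + Suc j) = merge_at p t (level r lam z j) i"
    if "1 \<le> i" "i \<le> m" for i
  proof (cases i p rule: linorder_cases)
    case less
    then have "gz_entry lam x i (i + Suc j) = gz_entry lam x i (i + Suc j - 1)"
      using below that(1) by simp
    then show ?thesis using IH[of i] that less by (simp add: merge_at_def)
  next
    case equal
    then show ?thesis by (simp add: merge_at_def t_def)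
  next
    case greater
    then have "gz_entry lam x i (i + Suc j) = gz_entry lam x (i + 1) (i + Suc j)"
      using above that(2) by (simp add: m_def)
    then show ?thesis using IH[of "Suc i"] that greater by (simp add: merge_at_def)
  qed
  have "gz_y n lam x (Suc j) = (\<Sum>i = 1..m. merge_at p t (level r lam z j) i)"
    unfolding gz_y_def m_def[symmetric] using entry by (intro sum.cong) simp_all
  also have "\<dots> = (\<Sum>i = 1..Suc m. level r lam z j i) - level r lam z j p - level r lam z j (Suc p) + t"
    by (rule sum_merge_at[OF p])
  also have "(\<Sum>i = 1..Suc m. level r lam z j i) = gz_y n lam x j"
    unfolding gz_y_def m using IH by (intro sum.cong) simp_all
  finally have "t = level r lam z j p + level r lam z j (Suc p) - z (Suc j)"
    using z[of j] Suc.prems(1) by simp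
  then show ?case using entry[of i] Suc.prems by (simp add: p_def m_def)
qed

lemma GZ_iff_level_bounds:
  assumes n: "1 \<le> n"
    and r: "\<And>i. 1 \<le> i \<Longrightarrow> i < n \<Longrightarrow> 1 \<le> r i \<and> r i \<le> n - i"
    and gz_r: "\<And>j. 1 \<le> j \<Longrightarrow> j < n \<Longrightarrow> gz_r n w j = r j"
    and lam: "\<And>k. 1 \<le> k \<Longrightarrow> k < n \<Longrightarrow> lam (Suc k) \<le> lam k"
  shows "v \<in> GZ n lam w \<longleftrightarrow> v \<in> carrier_vec n \<and>
     level_bounds r lam (\<lambda>i. v $ (i - 1)) (n - 1) \<and>
     v $ (n - 1) = level r lam (\<lambda>i. v $ (i - 1)) (n - 1) 1"
proof
  assume "v \<in> GZ n lam w"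
  then obtain x where x: "x \<in> GZ_face n lam w" and v: "v = GZ_map n lam x"
    by (auto simp: GZ_def)
  define z where "z i = v $ (i - 1)" for i
  have z: "z (Suc j) = gz_y n lam x j - gz_y n lam x (Suc j)" if "Suc j < n" for j
    using that by (simp add: z_def v GZ_map_def)
  note entry = gz_entry_eq_level[where r = r and z = z, OF r gz_r x z]
  have "level r lam z i (Suc (r (Suc i))) \<le> z (Suc i) \<and> z (Suc i) \<le> level r lam z i (r (Suc i))"
    if i: "i < n - 1" for i
  proof -
    define p where "p = r (Suc i)"
    have p: "1 \<le> p" "p + i \<le> n - 1"
    proof -
      have "1 \<le> r (Suc i) \<and> r (Suc i) \<le> n - Suc i" using i by (intro r) simp_all
      then show "1 \<le> p" "p + i \<le> n - 1" unfolding p_def using i by linarith+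
    qed
    \<comment> \<open>Interlacing at the free entry \<open>u + v - z\<close> is equivalent to
      \<open>v \<le> z \<le> u\<close>.\<close>
    have "gz_entry lam x p (p + i) \<ge> gz_entry lam x p (p + i + 1) \<and>
        gz_entry lam x p (p + i + 1) \<ge> gz_entry lam x (p + 1) (p + i + 1)"
      using x p by (simp add: GZ_face_def GZ_polytope_def)
    moreover have "gz_entry lam x p (p + i) = level r lam z i p"
      using p i by (intro entry) simp_all
    moreover have "gz_entry lam x (Suc p) (Suc p + i) = level r lam z i (Suc p)"
      using p i by (intro entry) simp_all
    moreover have "gz_entry lam x p (p + Suc i) = level r lam z (Suc i) p"
      using p i by (intro entry) simp_all
    ultimately show ?thesis by (simp add: p_def merge_at_def)
  qed
  then have "level_bounds r lam z (n - 1)" by (simp add: level_bounds_def)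
  moreover have "v $ (n - 1) = level r lam z (n - 1) 1"
  proof -
    have "v $ (n - 1) = gz_y n lam x (n - 1)" using n by (simp add: v GZ_map_def)
    also have "\<dots> = gz_entry lam x 1 (1 + (n - 1))" using n by (simp add: gz_y_def)
    also have "\<dots> = level r lam z (n - 1) 1" using n by (intro entry) simp_all
    finally show ?thesis .
  qed
  moreover have "v \<in> carrier_vec n" by (simp add: v GZ_map_def)
  moreover have "z = (\<lambda>i. v $ (i - 1))" by (simp add: z_def fun_eq_iff)
  ultimately show "v \<in> carrier_vec n \<and> level_bounds r lam (\<lambda>i. v $ (i - 1)) (n - 1) \<and>
     v $ (n - 1) = level r lam (\<lambda>i. v $ (i - 1)) (n - 1) 1" by simp
next
  define z where "z = (\<lambda>i. v $ (i - 1))"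
  assume "v \<in> carrier_vec n \<and> level_bounds r lam (\<lambda>i. v $ (i - 1)) (n - 1) \<and>
     v $ (n - 1) = level r lam (\<lambda>i. v $ (i - 1)) (n - 1) 1"
  then have v: "v \<in> carrier_vec n" and bounds: "level_bounds r lam z (n - 1)"
    and last: "v $ (n - 1) = level r lam z (n - 1) 1"
    by (simp_all add: z_def)
  define x where "x = restrict (\<lambda>(k, l). level r lam z (l - k) k) {(k, l). 1 \<le> k \<and> k < l \<and> l \<le> n}"
  have entry: "gz_entry lam x i (i + j) = level r lam z j i" if "1 \<le> i" "i + j \<le> n" for i j
    using that by (cases j) (simp_all add: gz_entry_def x_def del: level.simps(2))
  have mono: "level r lam z j (Suc k) \<le> level r lam z j k" if "1 \<le> k" "k < n - j" "j < n" for j k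
  proof -
    have "level_bounds r lam z j" using bounds that(3) by (simp add: level_bounds_def)
    then show ?thesis using that by (intro level_antimono[of n r lam, OF r lam])
  qed
  have poly: "x \<in> GZ_polytope n lam"
    unfolding GZ_polytope_def
  proof (intro CollectI conjI allI impI)
    show "x \<in> {(k, l). 1 \<le> k \<and> k < l \<and> l \<le> n} \<rightarrow>\<^sub>E UNIV" by (simp add: x_def)
  next
    fix i j assume ij: "1 \<le> i \<and> i \<le> j \<and> j \<le> n - 1"
    define d where "d = j - i"
    have d: "j = i + d" "Suc (i + d) \<le> n" "i < n - d" "d < n" "d < n - 1"
      using ij n by (auto simp: d_def)
    have e: "gz_entry lam x i j = level r lam z d i"
      "gz_entry lam x i (j + 1) = level r lam z (Suc d) i"
      "gz_entry lam x (i + 1) (j + 1) = level r lam z d (Suc i)"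
      using entry[of i d] entry[of i "Suc d"] entry[of "Suc i" d] ij d(1,2)
      by (simp_all del: level.simps(2))
    have b: "level r lam z d (Suc (r (Suc d))) \<le> z (Suc d)" "z (Suc d) \<le> level r lam z d (r (Suc d))"
      using bounds d(5) by (simp_all add: level_bounds_def)
    have mi: "level r lam z d (Suc i) \<le> level r lam z d i" using ij d by (intro mono) simp_all
    \<comment> \<open>Away from the free entry one inequality is an equality and the other is
      monotonicity of the previous level.\<close>
    have "level r lam z (Suc d) i \<le> level r lam z d i \<and> level r lam z d (Suc i) \<le> level r lam z (Suc d) i"
    proof (cases "i = r (Suc d)")
      case True
      then show ?thesis using b by (simp add: merge_at_def)
    next
      case False
      then show ?thesis using mi by (simp add: merge_at_def)
    qed
    then show "gz_entry lam x i (j + 1) \<le> gz_entry lam x i j"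
      "gz_entry lam x (i + 1) (j + 1) \<le> gz_entry lam x i (j + 1)"
      unfolding e by simp_all
  qed
  have "x \<in> GZ_face n lam w"
    unfolding GZ_face_def
  proof (intro CollectI conjI ballI allI impI poly)
    fix j i assume j: "j \<in> {1..n - 1}" and i: "1 \<le> i \<and> i + 1 \<le> gz_r n w j"
    then obtain d where d: "j = Suc d" by (cases j) auto
    have "i < r j" "r j \<le> n - j" "j < n" using j i gz_r[of j] r[of j] by auto
    then show "gz_entry lam x i (i + j) = gz_entry lam x i (i + j - 1)"
      using entry[of i j] entry[of i d] i by (simp add: d merge_at_def)
  next
    fix j i assume j: "j \<in> {1..n - 1}" and i: "gz_r n w j + 1 \<le> i \<and> i \<le> n - j"
    then obtain d where d: "j = Suc d" by (cases j) auto
    have "r j < i" "i + j \<le> n" using j i gz_r[of j] by auto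
    then show "gz_entry lam x i (i + j) = gz_entry lam x (i + 1) (i + j)"
      using entry[of i j] entry[of "Suc i" d] i by (simp add: d merge_at_def)
  qed
  moreover have "GZ_map n lam x = v"
  proof (rule eq_vecI)
    show "dim_vec (GZ_map n lam x) = dim_vec v" using v by (simp add: GZ_map_def)
    have y: "gz_y n lam x j = (\<Sum>i = 1..n - j. level r lam z j i)" if "j < n" for j
      unfolding gz_y_def using that by (intro sum.cong entry) auto
    fix k assume "k < dim_vec v"
    then have k: "k < n" using v by simp
    show "GZ_map n lam x $ k = v $ k"
    proof (cases "k = n - 1")
      case True
      then show ?thesis using k last n y[of "n - 1"] by (simp add: GZ_map_def)
    next
      case False
      define p where "p = r (Suc k)"
      define m where "m = n - Suc k"
      have m: "n - k = Suc m" "Suc k < n" using k False by (simp_all add: m_def)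
      have p: "1 \<le> p" "p \<le> m" using r[of "Suc k"] m by (simp_all add: p_def m_def)
      \<comment> \<open>Merging \<open>u\<close> and \<open>v\<close> into \<open>u + v - z\<close>
        lowers the diagonal sum by exactly \<open>z\<close>, which is the coordinate wanted.\<close>
      have "gz_y n lam x (Suc k) =
          (\<Sum>i = 1..m. merge_at p (level r lam z k p + level r lam z k (Suc p) - z (Suc k)) (level r lam z k) i)"
        using y[OF m(2)] by (simp add: m_def p_def)
      also have "\<dots> = (\<Sum>i = 1..Suc m. level r lam z k i) - z (Suc k)"
        by (subst sum_merge_at[OF p]) simp
      also have "(\<Sum>i = 1..Suc m. level r lam z k i) = gz_y n lam x k"
        using y[OF k] m(1) by simp
      finally have "gz_y n lam x k - gz_y n lam x (k + 1) = z (Suc k)" by simp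
      then show ?thesis using k False by (simp add: GZ_map_def z_def)
    qed
  qed
  ultimately show "v \<in> GZ n lam w" unfolding GZ_def by blast
qed

section \<open>Genericity and conclusion\<close>

lemma generically_nonzero:
  assumes "finite V" "\<And>a. (\<forall>v\<in>V. a v \<noteq> 0) \<Longrightarrow> P a"
  shows "generically V P"
proof -
  \<comment> \<open>The polynomial is the product of all variables in \<open>V\<close>, nonzero
    exactly where every entry is.\<close>
  define M :: "'a \<Rightarrow>\<^sub>0 nat" where "M = (\<Sum>v\<in>V. Poly_Mapping.single v 1)"
  have lookup: "Poly_Mapping.lookup M v = (if v \<in> V then 1 else 0)" for v
    using assms(1) by (simp add: M_def lookup_sum lookup_single when_def)
  have keys: "Poly_Mapping.keys M = V"
    by (auto simp: in_keys_iff lookup split: if_splits)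
  define p :: "('a \<Rightarrow>\<^sub>0 nat) \<Rightarrow>\<^sub>0 complex" where "p = Poly_Mapping.single M 1"
  have keys_p: "Poly_Mapping.keys p = {M}" by (simp add: p_def)
  have "mpoly_eval p a = (\<Prod>v\<in>V. a v)" for a
    using keys by (simp add: mpoly_eval_def keys_p lookup) (simp add: p_def)
  then have "mpoly_eval p a \<noteq> 0 \<longleftrightarrow> (\<forall>v\<in>V. a v \<noteq> 0)" for a
    using assms(1) by simp
  moreover have "p \<noteq> 0" using keys_p by auto
  ultimately show ?thesis
    unfolding generically_def using assms(2) keys keys_p by (intro exI[of _ p]) auto
qed

theorem theorem5p0p6:
  fixes n :: nat and w :: "nat \<Rightarrow> nat"
  assumes "n \<ge> 2" and "w permutes {1..n - 1}"
  shows "generically (star_positions n w)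
           (\<lambda>a. \<forall>lam :: nat \<Rightarrow> real.
              (\<forall>j \<in> {1..n - 1}. lam j \<ge> lam (j + 1)) \<and> lam n \<ge> 0 \<longrightarrow>
              FM n lam (A_mat n w a) = GZ n lam w)"
proof -
  have "FM n lam (A_mat n w a) = GZ n lam w"
    if a: "\<forall>v\<in>star_positions n w. a v \<noteq> 0"
      and decreasing: "\<forall>j\<in>{1..n - 1}. lam j \<ge> lam (j + 1)" and lam_n: "0 \<le> lam n"
    for a and lam :: "nat \<Rightarrow> real"
  proof (rule Set.set_eqI)
    fix z
    have lam: "lam (Suc k) \<le> lam k" if "1 \<le> k" "k < n" for k
      using decreasing that by simp
    have nonneg: "0 \<le> lam k" if "1 \<le> k" "k \<le> n" for k
      using that(2,1)
    proof (induction rule: inc_induct)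
      case (step m)
      then show ?case using lam[of m] by simp
    qed (use lam_n in simp)
    have gz_r: "gz_r n w j = pivot_pos n w j" if "1 \<le> j" "j < n" for j
      using that by (simp add: pivot_pos_def)
    have n: "1 \<le> n" using assms(1) by simp
    note pivot = pivot_pos_bounds[OF assms]
    \<comment> \<open>Both memberships reduce to the same level bounds and the same value of the
      last coordinate.\<close>
    show "z \<in> FM n lam (A_mat n w a) \<longleftrightarrow> z \<in> GZ n lam w"
      using FM_A_mat_iff[OF assms a, of z lam]
        GZ_iff_level_bounds[of n "pivot_pos n w" w lam z, OF n pivot gz_r lam]
        stage_polytope_iff_level_bounds[of n "pivot_pos n w" lam "\<lambda>i. z $ (i - 1)",
          OF pivot pivot_pos_n[OF assms] nonneg n]
      by simp
  qed
  moreover have "finite (star_positions n w)" by (simp add: star_positions_def)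
  ultimately show ?thesis by (intro generically_nonzero) blast+
qed

end
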